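(* Let $G$ and $H$ be two connected graphs. Then $\kappa_3(G\circ H)\geq \kappa_3(G)\,|V(H)|$. Moreover, the bound is sharp, i.e., there exist connected graphs $G,H$ for which equality holds.
   Context: All graphs are finite, simple and undirected. For $S\subseteq V(G)$ with $|S|\ge 2$, an $S$-tree is a subgraph of $G$ that is a tree containing $S$; two $S$-trees $T,T'$ are internally disjoint if $E(T)\cap E(T')=\varnothing$ and $V(T)\cap V(T')=S$. $\kappa(S)$ is the maximum number of pairwise internally disjoint $S$-trees in $G$. For $2\le k\le |V(G)|$, $\kappa_k(G)=\min\{\kappa(S): S\subseteq V(G),\ |S|=k\}$; by convention $\kappa_k(G)=1$ if $G$ is connected with fewer than $k$ vertices, and $\kappa_k(G)=0$ if $G$ is disconnected. $G\circ H$ is the lexicographic product: vertex set $V(G)\times V(H)$, with distinct $(u,v),(u',v')$ adjacent iff either $uu'\in E(G)$, or $u=u'$ and $vv'\in E(H)$.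
   Formalization: The graph G is required to have at least two vertices: with the convention κ_3(K_1)=1 the bound fails for G=K_1, H=K_2, since K_1∘K_2=K_2 gives κ_3=1<2. *)

theory Defs
  imports Main
begin

record 'a ugraph =
  verts :: "'a set"
  edges :: "'a set set"

definition simple_graph :: "'a ugraph \<Rightarrow> bool" where
  "simple_graph G \<longleftrightarrow>
     finite (verts G) \<and> (\<forall>e\<in>edges G. e \<subseteq> verts G \<and> card e = 2)"

definition adj :: "'a ugraph \<Rightarrow> 'a \<Rightarrow> 'a \<Rightarrow> bool" where
  "adj G u v \<longleftrightarrow> {u, v} \<in> edges G"

definition connected_graph :: "'a ugraph \<Rightarrow> bool" where
  "connected_graph G \<longleftrightarrow>
     simple_graph G \<and> verts G \<noteq> {} \<and>
     (\<forall>u\<in>verts G. \<forall>v\<in>verts G. (adj G)\<^sup>*\<^sup>* u v)"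

definition is_cycle :: "'a ugraph \<Rightarrow> 'a list \<Rightarrow> bool" where
  "is_cycle G p \<longleftrightarrow>
     length p \<ge> 3 \<and> distinct p \<and> successively (adj G) p \<and> adj G (last p) (hd p)"

definition tree :: "'a ugraph \<Rightarrow> bool" where
  "tree T \<longleftrightarrow> connected_graph T \<and> (\<nexists>p. is_cycle T p)"

definition subgraph :: "'a ugraph \<Rightarrow> 'a ugraph \<Rightarrow> bool" where
  "subgraph T G \<longleftrightarrow> verts T \<subseteq> verts G \<and> edges T \<subseteq> edges G"

definition steiner_tree :: "'a ugraph \<Rightarrow> 'a set \<Rightarrow> 'a ugraph \<Rightarrow> bool" where
  "steiner_tree G S T \<longleftrightarrow> tree T \<and> subgraph T G \<and> S \<subseteq> verts T"

definition internally_disjoint :: "'a set \<Rightarrow> 'a ugraph \<Rightarrow> 'a ugraph \<Rightarrow> bool" where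
  "internally_disjoint S T T' \<longleftrightarrow>
     edges T \<inter> edges T' = {} \<and> verts T \<inter> verts T' = S"

definition kappa_set :: "'a ugraph \<Rightarrow> 'a set \<Rightarrow> nat" where
  "kappa_set G S =
     Max {card F | F. (\<forall>T\<in>F. steiner_tree G S T) \<and> pairwise (internally_disjoint S) F}"

definition kappa :: "nat \<Rightarrow> 'a ugraph \<Rightarrow> nat" where
  "kappa k G =
     (if \<not> connected_graph G then 0
      else if card (verts G) < k then 1
      else Min {kappa_set G S | S. S \<subseteq> verts G \<and> card S = k})"

definition lex_product :: "'a ugraph \<Rightarrow> 'b ugraph \<Rightarrow> ('a \<times> 'b) ugraph" where
  "lex_product G H =
     \<lparr>verts = verts G \<times> verts H,
      edges = {{(u, v), (u', v')} | u v u' v'.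
        u \<in> verts G \<and> u' \<in> verts G \<and> v \<in> verts H \<and> v' \<in> verts H \<and>
        (u, v) \<noteq> (u', v') \<and>
        ({u, u'} \<in> edges G \<or> u = u' \<and> {v, v'} \<in> edges H)}\<rparr>"

text \<open>
  The inequality \<open>kappa 3 (lex_product G H) \<ge> kappa 3 G * card (verts H)\<close> fails for the
  one-vertex graph \<open>G\<close>: then \<open>kappa 3 G = 1\<close> by convention and \<open>lex_product G H\<close> is a copy
  of \<open>H\<close>. The first factor is therefore required to be nontrivial.
\<close>

lemma lex_product_bound_fails_for_trivial_graph:
  defines "G \<equiv> \<lparr>verts = {0::nat}, edges = {}\<rparr>"
    and "H \<equiv> \<lparr>verts = {0::nat, 1}, edges = {{0, 1}}\<rparr>"
  shows "connected_graph G" and "connected_graph H"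
    and "kappa 3 (lex_product G H) < kappa 3 G * card (verts H)"
proof -
  show G: "connected_graph G"
    by (simp add: G_def connected_graph_def simple_graph_def)
  have "adj H 0 1" "adj H 1 0"
    by (auto simp: H_def adj_def)
  then show "connected_graph H"
    by (auto simp: H_def connected_graph_def simple_graph_def)
  have "card (verts (lex_product G H)) = 2"
    by (simp add: G_def H_def lex_product_def card_cartesian_product)
  then have "kappa 3 (lex_product G H) \<le> 1"
    by (simp add: kappa_def)
  moreover have "kappa 3 G = 1"
    using G by (simp add: kappa_def) (simp add: G_def)
  ultimately show "kappa 3 (lex_product G H) < kappa 3 G * card (verts H)"
    by (simp add: H_def)
qed

end

theory Submission imports Defs begin

text \<open>
  A Steiner tree may be replaced by any connected subgraph containing \<open>S\<close>, so only two things have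
  to be shared out among the trees: vertices outside \<open>S\<close> and edges inside \<open>S\<close>. Let \<open>m\<close> be the order
  of \<open>H\<close>. A connector in \<open>G\<close> that uses no edge inside \<open>S\<close> gives \<open>m\<close> disjoint connectors in
  \<open>G \<circ> H\<close>, one for each layer of \<open>H\<close>; the edges inside \<open>S\<close> are where work is needed.

  If the three terminals project to distinct vertices of \<open>G\<close>, a connector that uses such an edge is
  multiplied with the help of the free vertices in the fibres over the terminals. Two connectors
  competing for the same fibre, with edges \<open>ec\<close> and \<open>cd\<close>, are recombined: one gets both edges, the
  other both inner parts. If the terminals project to \<open>u, u, v\<close>, the bound needs \<open>\<kappa>\<^sub>3(G)\<close> internally
  disjoint \<open>u\<close>-\<open>v\<close> paths. These come from Menger's theorem, since deleting fewer than \<open>\<kappa>\<^sub>3(G)\<close>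
  vertices cannot separate \<open>G\<close>. If all terminals lie over \<open>u\<close>, stars centred in the fibres over the
  neighbours of \<open>u\<close> suffice. Equality holds for \<open>K\<^sub>2\<close> and \<open>K\<^sub>1\<close>.
\<close>

section \<open>Steiner trees and packings of connectors\<close>

lemma rtranclp_lift:
  assumes "r\<^sup>*\<^sup>* a b" and "\<And>x y. r x y \<Longrightarrow> s\<^sup>*\<^sup>* (f x) (f y)"
  shows "s\<^sup>*\<^sup>* (f a) (f b)"
  using assms(1) by induction (auto intro: rtranclp_trans assms(2))

lemma successively_imp_rtranclp_last:
  "successively r (x # xs) \<Longrightarrow> r\<^sup>*\<^sup>* x (last (x # xs))"
  by (induction xs arbitrary: x) (auto intro: converse_rtranclp_into_rtranclp)

lemma adj_commute: "adj G a b \<longleftrightarrow> adj G b a"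
  by (simp add: adj_def insert_commute)

lemma symp_adj: "symp (adj G)"
  by (simp add: symp_def adj_commute)

lemma simple_graph_edgeD:
  assumes "simple_graph G" "{a, b} \<in> edges G"
  shows "a \<in> verts G" "b \<in> verts G" "a \<noteq> b"
  using assms unfolding simple_graph_def by force+

lemma finite_edges: "simple_graph G \<Longrightarrow> finite (edges G)"
  by (rule finite_subset[of _ "Pow (verts G)"]) (auto simp: simple_graph_def)

text \<open>The rest of the cycle is a walk between the ends of the closing edge, so every use of
  that edge can be rerouted.\<close>

lemma connected_remove_cycle_edge:
  assumes conn: "connected_graph G" and cyc: "is_cycle G p"
  shows "connected_graph \<lparr>verts = verts G, edges = edges G - {{last p, hd p}}\<rparr>"
proof -
  let ?e = "{last p, hd p}" and ?G = "\<lparr>verts = verts G, edges = edges G - {{last p, hd p}}\<rparr>"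
  from cyc have p: "length p \<ge> 3" "distinct p" "successively (adj G) p"
    by (auto simp: is_cycle_def)
  have "adj ?G (p ! i) (p ! Suc i)" if "Suc i < length p" for i
  proof -
    have "adj G (p ! i) (p ! Suc i)"
      using p(3) that by (simp add: successively_conv_nth)
    \<comment> \<open>Two consecutive positions would have to be the first and the last one, which
      \<open>length p \<ge> 3\<close> excludes.\<close>
    moreover have "{p ! i, p ! Suc i} \<noteq> ?e"
    proof
      assume *: "{p ! i, p ! Suc i} = ?e"
      have "last p = p ! (length p - 1)" "hd p = p ! 0"
        using p(1) by (cases "p = []"; simp add: last_conv_nth hd_conv_nth)+
      then have "{p ! i, p ! Suc i} = {p ! (length p - 1), p ! 0}"
        using * by simp
      then show False
        using p(1) that nth_eq_iff_index_eq[OF p(2), of i "length p - 1"]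
          nth_eq_iff_index_eq[OF p(2), of i 0] nth_eq_iff_index_eq[OF p(2), of "Suc i" "length p - 1"]
        unfolding doubleton_eq_iff by linarith
    qed
    ultimately show ?thesis by (simp add: adj_def)
  qed
  then have "successively (adj ?G) p"
    by (simp add: successively_conv_nth)
  then have "(adj ?G)\<^sup>*\<^sup>* (hd p) (last p)"
    using p(1) successively_imp_rtranclp_last[of "adj ?G" "hd p" "tl p"] by (cases p) auto
  then have *: "(adj ?G)\<^sup>*\<^sup>* (last p) (hd p)" "(adj ?G)\<^sup>*\<^sup>* (hd p) (last p)"
    by (auto intro: sympD[OF symp_rtranclp[OF symp_adj]])
  have step: "(adj ?G)\<^sup>*\<^sup>* a b" if "adj G a b" for a b
  proof (cases "{a, b} = ?e")
    case True
    then show ?thesis using * by (auto simp: doubleton_eq_iff)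
  next
    case False
    then have "adj ?G a b" using that by (simp add: adj_def)
    then show ?thesis ..
  qed
  have "(adj ?G)\<^sup>*\<^sup>* a b" if "(adj G)\<^sup>*\<^sup>* a b" for a b
    using rtranclp_lift[OF that, of "adj ?G" "\<lambda>x. x"] step by simp
  then show ?thesis
    using conn by (simp add: connected_graph_def simple_graph_def)
qed

text \<open>A connected edge set of least cardinality has no cycle, because deleting a cycle edge
  would leave it connected.\<close>

lemma spanning_tree_exists:
  assumes "connected_graph G"
  obtains T where "tree T" "verts T = verts G" "edges T \<subseteq> edges G"
proof -
  let ?P = "\<lambda>E. E \<subseteq> edges G \<and> connected_graph \<lparr>verts = verts G, edges = E\<rparr>"
  have "?P (edges G)"
    using assms by (cases G) simp
  then obtain E where E: "?P E" and min: "\<And>E'. ?P E' \<Longrightarrow> card E \<le> card E'"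
    using ex_has_least_nat[of ?P "edges G" card] by blast
  let ?T = "\<lparr>verts = verts G, edges = E\<rparr>"
  have "\<not> is_cycle ?T p" for p
  proof
    assume cyc: "is_cycle ?T p"
    let ?e = "{last p, hd p}"
    have "?P (E - {?e})"
      using connected_remove_cycle_edge[OF _ cyc] E by auto
    then have "card E \<le> card (E - {?e})"
      by (rule min)
    moreover have "?e \<in> E"
      using cyc by (simp add: is_cycle_def adj_def)
    moreover have "finite E"
      using E finite_edges[of G] assms by (auto simp: connected_graph_def intro: finite_subset)
    ultimately show False
      by (metis card_Diff1_less not_le)
  qed
  then show thesis
    using E that[of ?T] by (auto simp: tree_def)
qed

text \<open>
  \<open>W\<close> holds the inner vertices and \<open>F\<close> the permitted edges between terminals; elements of \<open>W\<close> in \<open>S\<close>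
  and elements of \<open>F\<close> that are not such edges have no effect.
\<close>

definition link :: "'a ugraph \<Rightarrow> 'a set \<Rightarrow> 'a set \<Rightarrow> 'a set set \<Rightarrow> 'a \<Rightarrow> 'a \<Rightarrow> bool" where
  "link G S W F a b \<longleftrightarrow>
     {a, b} \<in> edges G \<and> a \<in> S \<union> W \<and> b \<in> S \<union> W \<and> (a \<in> S \<and> b \<in> S \<longrightarrow> {a, b} \<in> F)"

definition joins :: "'a ugraph \<Rightarrow> 'a set \<Rightarrow> 'a set \<Rightarrow> 'a set set \<Rightarrow> bool" where
  "joins G S W F \<longleftrightarrow> (\<forall>a\<in>S. \<forall>b\<in>S. (link G S W F)\<^sup>*\<^sup>* a b)"

text \<open>Connectors are indexed instead of collected in a set, so that lists can index paths and
  pairs of an old index and a vertex of \<open>H\<close> can index connectors of the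
  product.\<close>

definition packing ::
  "'a ugraph \<Rightarrow> 'a set \<Rightarrow> 'i set \<Rightarrow> ('i \<Rightarrow> 'a set) \<Rightarrow> ('i \<Rightarrow> 'a set set) \<Rightarrow> bool" where
  "packing G S I W F \<longleftrightarrow>
     (\<forall>i\<in>I. joins G S (W i) (F i)) \<and>
     (\<forall>i\<in>I. \<forall>j\<in>I. i \<noteq> j \<longrightarrow> W i \<inter> W j \<subseteq> S \<and> F i \<inter> F j = {})"

lemma link_commute: "link G S W F a b \<longleftrightarrow> link G S W F b a"
  by (auto simp: link_def insert_commute)

lemma link_rtranclp_sym: "(link G S W F)\<^sup>*\<^sup>* a b \<Longrightarrow> (link G S W F)\<^sup>*\<^sup>* b a"
  by (rule sympD[OF symp_rtranclp]) (simp_all add: symp_def link_commute)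

lemma link_rtranclp_mono:
  assumes "(link G S W F)\<^sup>*\<^sup>* a b" "W \<subseteq> W'" "F \<subseteq> F'"
  shows "(link G S W' F')\<^sup>*\<^sup>* a b"
  by (rule mono_rtranclp[THEN mp, OF _ assms(1)]) (use assms in \<open>auto simp: link_def\<close>)

lemma joinsI:
  assumes "\<And>s. s \<in> S \<Longrightarrow> (link G S W F)\<^sup>*\<^sup>* a s"
  shows "joins G S W F"
  using assms unfolding joins_def by (meson link_rtranclp_sym rtranclp_trans)

lemma packing_mono:
  assumes "packing G S I W F" "J \<subseteq> I"
  shows "packing G S J W F"
  using assms unfolding packing_def by blast

text \<open>The vertices reachable by links from one terminal form a connected subgraph all of whose
  edges are links. A spanning tree of it inherits the restriction on edges inside
  \<open>S\<close>.\<close>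

lemma joins_steiner_tree:
  assumes G: "simple_graph G" and S: "S \<noteq> {}" "S \<subseteq> verts G" and J: "joins G S W F"
  obtains T where "steiner_tree G S T" "verts T \<subseteq> S \<union> W"
    "\<And>e. e \<in> edges T \<Longrightarrow> e \<subseteq> S \<Longrightarrow> e \<in> F"
proof -
  let ?r = "link G S W F"
  obtain s where s: "s \<in> S" using S by blast
  define C where "C = \<lparr>verts = {b. ?r\<^sup>*\<^sup>* s b}, edges = {{a, b} |a b. ?r\<^sup>*\<^sup>* s a \<and> ?r a b}\<rparr>"
  have vC: "verts C \<subseteq> verts G" "verts C \<subseteq> S \<union> W"
  proof -
    have "b \<in> verts G \<and> b \<in> S \<union> W" if "?r\<^sup>*\<^sup>* s b" for b
      using that by induction (use s S simple_graph_edgeD[OF G] in \<open>auto simp: link_def\<close>)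
    then show "verts C \<subseteq> verts G" "verts C \<subseteq> S \<union> W"
      by (auto simp: C_def)
  qed
  have eC: "edges C \<subseteq> edges G"
    by (auto simp: C_def link_def)
  have "connected_graph C"
    unfolding connected_graph_def simple_graph_def
  proof (intro conjI ballI)
    show "finite (verts C)"
      using vC G by (auto simp: simple_graph_def intro: finite_subset)
    show "verts C \<noteq> {}"
      by (auto simp: C_def)
    show "e \<subseteq> verts C" if "e \<in> edges C" for e
      using that by (auto simp: C_def intro: rtranclp.rtrancl_into_rtrancl)
    show "card e = 2" if "e \<in> edges C" for e
      using that eC G by (auto simp: simple_graph_def)
  next
    have *: "(adj C)\<^sup>*\<^sup>* s b" if "?r\<^sup>*\<^sup>* s b" for b
      using that
    proof induction
      case (step y z)
      then have "adj C y z" by (auto simp: adj_def C_def)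
      then show ?case using step by (simp add: rtranclp.rtrancl_into_rtrancl)
    qed simp
    fix a b assume "a \<in> verts C" "b \<in> verts C"
    then have "(adj C)\<^sup>*\<^sup>* s a" "(adj C)\<^sup>*\<^sup>* s b"
      using * by (simp_all add: C_def)
    then show "(adj C)\<^sup>*\<^sup>* a b"
      by (meson rtranclp_trans sympD[OF symp_rtranclp[OF symp_adj]])
  qed
  then obtain T where T: "tree T" "verts T = verts C" "edges T \<subseteq> edges C"
    by (rule spanning_tree_exists)
  have "steiner_tree G S T"
    using T vC eC J s by (auto simp: steiner_tree_def subgraph_def C_def joins_def)
  moreover have "e \<in> F" if "e \<in> edges T" "e \<subseteq> S" for e
    using that T by (auto simp: C_def link_def)
  ultimately show thesis
    using that T vC by auto
qed

section \<open>Passing between families of Steiner trees and packings\<close>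

lemma finite_subgraphs:
  assumes "simple_graph (G :: 'a ugraph)"
  shows "finite {T :: 'a ugraph. subgraph T G}"
proof (rule finite_subset)
  show "{T. subgraph T G} \<subseteq> (\<lambda>(V, E). \<lparr>verts = V, edges = E\<rparr>) ` (Pow (verts G) \<times> Pow (edges G))"
  proof
    fix T :: "'a ugraph" assume "T \<in> {T. subgraph T G}"
    then show "T \<in> (\<lambda>(V, E). \<lparr>verts = V, edges = E\<rparr>) ` (Pow (verts G) \<times> Pow (edges G))"
      by (intro image_eqI[of _ _ "(verts T, edges T)"]) (auto simp: subgraph_def)
  qed
  show "finite ((\<lambda>(V, E). \<lparr>verts = V, edges = E\<rparr>) ` (Pow (verts G) \<times> Pow (edges G)))"
    using assms finite_edges by (auto simp: simple_graph_def)
qed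

lemma finite_steiner_family:
  assumes "simple_graph G" "\<forall>T\<in>F. steiner_tree G S T"
  shows "finite F"
  using assms by (auto simp: steiner_tree_def intro: finite_subset[OF _ finite_subgraphs])

lemma finite_steiner_family_cards:
  assumes "simple_graph G"
  shows "finite {card F |F. (\<forall>T\<in>F. steiner_tree G S T) \<and> pairwise (internally_disjoint S) F}"
proof (rule finite_subset)
  let ?U = "{T. subgraph T G}"
  show "{card F |F. (\<forall>T\<in>F. steiner_tree G S T) \<and> pairwise (internally_disjoint S) F} \<subseteq> card ` Pow ?U"
    by (auto simp: steiner_tree_def)
  show "finite (card ` Pow ?U)"
    using finite_subgraphs[OF assms] by simp
qed

text \<open>One tree is picked inside each connector. Two of these trees meet only in
  \<open>S\<close>, so a common edge would be a permitted edge of both. Distinct indices give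
  distinct trees because a tree on at least two terminals has an edge.\<close>

lemma packing_le_kappa_set:
  assumes G: "simple_graph G" and S: "S \<subseteq> verts G" "card S \<ge> 2"
    and P: "packing G S I W F" and I: "finite I"
  shows "card I \<le> kappa_set G S"
proof -
  have ne: "S \<noteq> {}" using S by auto
  have "\<forall>i\<in>I. \<exists>T. steiner_tree G S T \<and> verts T \<subseteq> S \<union> W i \<and> (\<forall>e\<in>edges T. e \<subseteq> S \<longrightarrow> e \<in> F i)"
  proof
    fix i assume "i \<in> I"
    then have "joins G S (W i) (F i)" using P by (simp add: packing_def)
    from joins_steiner_tree[OF G ne S(1) this]
    show "\<exists>T. steiner_tree G S T \<and> verts T \<subseteq> S \<union> W i \<and> (\<forall>e\<in>edges T. e \<subseteq> S \<longrightarrow> e \<in> F i)"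
      by metis
  qed
  then obtain T where T: "\<And>i. i \<in> I \<Longrightarrow> steiner_tree G S (T i)"
    "\<And>i. i \<in> I \<Longrightarrow> verts (T i) \<subseteq> S \<union> W i"
    "\<And>i e. i \<in> I \<Longrightarrow> e \<in> edges (T i) \<Longrightarrow> e \<subseteq> S \<Longrightarrow> e \<in> F i"
    by metis
  have eT: "e \<subseteq> verts (T i)" if "i \<in> I" "e \<in> edges (T i)" for i e
    using T(1)[OF that(1)] that(2)
    by (auto simp: steiner_tree_def tree_def connected_graph_def simple_graph_def)
  have dis: "internally_disjoint S (T i) (T j)" if ij: "i \<in> I" "j \<in> I" "i \<noteq> j" for i j
  proof -
    have d: "W i \<inter> W j \<subseteq> S" "F i \<inter> F j = {}"
      using P ij by (auto simp: packing_def)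
    have v: "verts (T i) \<inter> verts (T j) = S"
      using T(1,2)[OF ij(1)] T(1,2)[OF ij(2)] d by (auto simp: steiner_tree_def)
    moreover have False if "e \<in> edges (T i)" "e \<in> edges (T j)" for e
    proof -
      have "e \<subseteq> S" using eT[OF ij(1) that(1)] eT[OF ij(2) that(2)] v by auto
      then show False using T(3) that ij d by blast
    qed
    ultimately show ?thesis by (auto simp: internally_disjoint_def)
  qed
  have nonempty: "edges (T i) \<noteq> {}" if "i \<in> I" for i
  proof
    assume e: "edges (T i) = {}"
    obtain a b where ab: "a \<in> S" "b \<in> S" "a \<noteq> b"
      using S by (metis card_le_Suc0_iff_eq card.infinite not_less_eq_eq numeral_2_eq_2 zero_le)
    have "(adj (T i))\<^sup>*\<^sup>* a b"
      using T(1)[OF that] ab by (auto simp: steiner_tree_def tree_def connected_graph_def)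
    then show False
      using ab e by (auto simp: adj_def elim: converse_rtranclpE)
  qed
  have inj: "inj_on T I"
  proof (rule inj_onI, rule ccontr)
    fix i j assume *: "i \<in> I" "j \<in> I" "T i = T j" "i \<noteq> j"
    then show False using dis[of i j] nonempty[of i] by (simp add: internally_disjoint_def)
  qed
  have "card (T ` I) \<le> kappa_set G S"
    unfolding kappa_set_def
  proof (rule Max_ge[OF finite_steiner_family_cards[OF G]], safe)
    have "\<forall>X\<in>T ` I. steiner_tree G S X" "pairwise (internally_disjoint S) (T ` I)"
      using T(1) dis unfolding pairwise_def by blast+
    then show "\<exists>F. card (T ` I) = card F \<and> (\<forall>T\<in>F. steiner_tree G S T) \<and> pairwise (internally_disjoint S) F"
      by blast
  qed
  then show ?thesis
    by (simp add: card_image[OF inj])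
qed

text \<open>An optimal family of Steiner trees serves as its own index set, with
  \<open>verts\<close> as inner parts and \<open>edges\<close> as permitted edges.\<close>

lemma kappa_set_packing:
  assumes G: "simple_graph (G :: 'a ugraph)"
  obtains I :: "'a ugraph set" and W F
  where "finite I" "card I = kappa_set G S" "packing G S I W F"
proof -
  let ?A = "{card F |F. (\<forall>T\<in>F. steiner_tree G S T) \<and> pairwise (internally_disjoint S) F}"
  \<comment> \<open>The empty family makes the set under \<open>Max\<close> nonempty, so the maximum
    is attained.\<close>
  have "card ({} :: 'a ugraph set) \<in> ?A"
    by (intro CollectI exI[of _ "{}"]) simp
  then have "kappa_set G S \<in> ?A"
    unfolding kappa_set_def using finite_steiner_family_cards[OF G] by (intro Max_in) auto
  then obtain I where I: "card I = kappa_set G S" "\<forall>T\<in>I. steiner_tree G S T"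
    "pairwise (internally_disjoint S) I"
    by auto
  have "joins G S (verts T) (edges T)" if "T \<in> I" for T
  proof -
    have T: "steiner_tree G S T" using I that by blast
    have "(link G S (verts T) (edges T))\<^sup>*\<^sup>* a b" if "(adj T)\<^sup>*\<^sup>* a b" for a b
      using that
    proof (rule mono_rtranclp[THEN mp, rotated], intro impI)
      fix x y assume "adj T x y"
      moreover from this have "x \<in> verts T" "y \<in> verts T"
        using T simple_graph_edgeD[of T x y]
        by (auto simp: steiner_tree_def tree_def connected_graph_def adj_def)
      ultimately show "link G S (verts T) (edges T) x y"
        using T by (auto simp: link_def adj_def steiner_tree_def subgraph_def)
    qed
    moreover have "(adj T)\<^sup>*\<^sup>* a b" if "a \<in> S" "b \<in> S" for a b
      using T that by (auto simp: steiner_tree_def tree_def connected_graph_def)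
    ultimately show ?thesis
      by (simp add: joins_def)
  qed
  moreover have "verts T \<inter> verts T' \<subseteq> S \<and> edges T \<inter> edges T' = {}"
    if "T \<in> I" "T' \<in> I" "T \<noteq> T'" for T T'
    using I(3) that by (auto simp: pairwise_def internally_disjoint_def)
  ultimately have "packing G S I verts edges"
    by (simp add: packing_def)
  then show thesis
    using that[of I] I finite_steiner_family[OF G I(2)] by blast
qed

section \<open>Menger's theorem\<close>

text \<open>The relation is directed, so an induction can delete one ordered pair at a time. A
  single vertex of \<open>A \<inter> B\<close> counts as a walk.\<close>

definition walk :: "('a \<times> 'a) set \<Rightarrow> 'a set \<Rightarrow> 'a set \<Rightarrow> 'a list \<Rightarrow> bool" where
  "walk r A B p \<longleftrightarrow> p \<noteq> [] \<and> successively (\<lambda>x y. (x, y) \<in> r) p \<and> hd p \<in> A \<and> last p \<in> B"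

definition separates :: "('a \<times> 'a) set \<Rightarrow> 'a set \<Rightarrow> 'a set \<Rightarrow> 'a set \<Rightarrow> bool" where
  "separates r A B X \<longleftrightarrow> (\<forall>p. walk r A B p \<longrightarrow> set p \<inter> X \<noteq> {})"

definition disjoint_paths :: "('a \<times> 'a) set \<Rightarrow> 'a set \<Rightarrow> 'a set \<Rightarrow> 'a list set \<Rightarrow> bool" where
  "disjoint_paths r A B P \<longleftrightarrow>
     (\<forall>p\<in>P. walk r A B p \<and> distinct p) \<and> (\<forall>p\<in>P. \<forall>q\<in>P. p \<noteq> q \<longrightarrow> set p \<inter> set q = {})"

lemma walk_mono: "walk r A B p \<Longrightarrow> r \<subseteq> r' \<Longrightarrow> walk r' A B p"
  by (auto simp: walk_def intro: successively_mono)

text \<open>No step starts at \<open>x\<close>, since only the final vertex \<open>s\<close> may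
  equal \<open>x\<close>.\<close>

lemma successively_insert_no_source:
  "successively (\<lambda>a b. (a, b) \<in> insert (x, y) r) (us @ [s]) \<Longrightarrow> x \<notin> set us
    \<Longrightarrow> successively (\<lambda>a b. (a, b) \<in> r) (us @ [s])"
  by (induction us) (auto simp: successively_Cons hd_append split: if_splits)

lemma successively_insert_no_target:
  "successively (\<lambda>a b. (a, b) \<in> insert (x, y) r) (s # vs) \<Longrightarrow> y \<notin> set vs
    \<Longrightarrow> successively (\<lambda>a b. (a, b) \<in> r) (s # vs)"
  by (induction vs arbitrary: s) auto

text \<open>A walk that misses \<open>x\<close> cannot use the new pair.\<close>

lemma separates_insert_source:
  assumes sep: "separates r A B X"
  shows "separates (insert (x, y) r) A B (insert x X)"
  unfolding separates_def
proof (intro allI impI notI)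
  fix p assume p: "walk (insert (x, y) r) A B p" "set p \<inter> insert x X = {}"
  have "successively (\<lambda>a b. (a, b) \<in> r) p"
    by (rule successively_mono[where P = "\<lambda>a b. (a, b) \<in> insert (x, y) r"])
      (use p in \<open>auto simp: walk_def\<close>)
  then have "walk r A B p" using p by (simp add: walk_def)
  then show False using sep p by (auto simp: separates_def)
qed

lemma separates_insert_target:
  assumes sep: "separates r A B X"
  shows "separates (insert (x, y) r) A B (insert y X)"
  unfolding separates_def
proof (intro allI impI notI)
  fix p assume p: "walk (insert (x, y) r) A B p" "set p \<inter> insert y X = {}"
  have "successively (\<lambda>a b. (a, b) \<in> r) p"
    by (rule successively_mono[where P = "\<lambda>a b. (a, b) \<in> insert (x, y) r"])
      (use p in \<open>auto simp: walk_def\<close>)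
  then have "walk r A B p" using p by (simp add: walk_def)
  then show False using sep p by (auto simp: separates_def)
qed

text \<open>Every walk from \<open>A\<close> to \<open>B\<close> meets \<open>insert x X\<close>. Up
  to the first such vertex it has not left \<open>x\<close>, so this initial segment is a walk in
  \<open>r\<close> and is caught by \<open>Z\<close>.\<close>

lemma separates_extend_source:
  assumes sep: "separates r A B X" and Z: "separates r A (insert x X) Z"
  shows "separates (insert (x, y) r) A B Z"
  unfolding separates_def
proof (intro allI impI)
  fix p assume p: "walk (insert (x, y) r) A B p"
  then have "\<exists>s\<in>set p. s \<in> insert x X"
    using separates_insert_source[OF sep] by (fastforce simp: separates_def)
  then obtain us s vs where us: "p = us @ s # vs" "s \<in> insert x X" "\<forall>u\<in>set us. u \<notin> insert x X"
    by (rule split_list_first_propE)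
  have "successively (\<lambda>a b. (a, b) \<in> insert (x, y) r) (us @ [s])"
    using p us by (auto simp: walk_def successively_append_iff)
  then have "successively (\<lambda>a b. (a, b) \<in> r) (us @ [s])"
    by (rule successively_insert_no_source) (use us in auto)
  then have "walk r A (insert x X) (us @ [s])"
    using p us by (auto simp: walk_def hd_append split: if_splits)
  then show "set p \<inter> Z \<noteq> {}"
    using Z us by (fastforce simp: separates_def)
qed

text \<open>The mirror image: after its last vertex in \<open>insert y X\<close> the walk does not
  enter \<open>y\<close>, so the final segment is caught by \<open>Z\<close>.\<close>

lemma separates_extend_target:
  assumes sep: "separates r A B X" and Z: "separates r (insert y X) B Z"
  shows "separates (insert (x, y) r) A B Z"
  unfolding separates_def
proof (intro allI impI)
  fix p assume p: "walk (insert (x, y) r) A B p"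
  then have "\<exists>s\<in>set p. s \<in> insert y X"
    using separates_insert_target[OF sep] by (fastforce simp: separates_def)
  then obtain us s vs where us: "p = us @ s # vs" "s \<in> insert y X" "\<forall>u\<in>set vs. u \<notin> insert y X"
    by (rule split_list_last_propE)
  have "successively (\<lambda>a b. (a, b) \<in> insert (x, y) r) (s # vs)"
    using p us by (auto simp: walk_def successively_append_iff)
  then have "successively (\<lambda>a b. (a, b) \<in> r) (s # vs)"
    by (rule successively_insert_no_target) (use us in auto)
  then have "walk r (insert y X) B (s # vs)"
    using p us by (auto simp: walk_def)
  then show "set p \<inter> Z \<noteq> {}"
    using Z us by (fastforce simp: separates_def)
qed

text \<open>Disjointness makes \<open>f\<close> injective and equal cardinalities make it onto
  \<open>Y\<close>; \<open>g\<close> is its inverse. A path meets \<open>Y\<close> only in its own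
  point, since every other point of \<open>Y\<close> lies on another path.\<close>

lemma disjoint_transversal:
  assumes Y: "finite Y" "card P = card Y"
    and f: "\<And>p. p \<in> P \<Longrightarrow> f p \<in> Y" "\<And>p. p \<in> P \<Longrightarrow> f p \<in> set p"
    and dis: "\<forall>p\<in>P. \<forall>q\<in>P. p \<noteq> q \<longrightarrow> set p \<inter> set q = {}"
  obtains g where "\<And>s. s \<in> Y \<Longrightarrow> g s \<in> P" "\<And>s. s \<in> Y \<Longrightarrow> f (g s) = s"
    "\<And>s. s \<in> Y \<Longrightarrow> set (g s) \<inter> Y = {s}"
proof -
  have inj: "inj_on f P"
    using f dis by (intro inj_onI) (metis IntI empty_iff)
  then have "f ` P = Y"
    using f Y by (intro card_subset_eq) (auto simp: card_image)
  define g where "g = inv_into P f"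
  have g: "g s \<in> P" "f (g s) = s" if "s \<in> Y" for s
    using that \<open>f ` P = Y\<close> by (auto simp: g_def intro: inv_into_into f_inv_into_f)
  have "set (g s) \<inter> Y = {s}" if "s \<in> Y" for s
  proof -
    have "t = s" if "t \<in> set (g s)" "t \<in> Y" for t
      using g[OF \<open>s \<in> Y\<close>] g[OF \<open>t \<in> Y\<close>] f(2) that dis by (metis IntI empty_iff)
    moreover have "s \<in> set (g s)"
      using g[OF that] f(2) by metis
    ultimately show ?thesis using that by auto
  qed
  then show thesis using that g by blast
qed

text \<open>
  Goering's induction on the number of edges: if deleting the edge \<open>(x, y)\<close> leaves a separator \<open>X\<close>
  that is too small, then paths from \<open>A\<close> to \<open>X \<union> {x}\<close> and from \<open>X \<union> {y}\<close> to \<open>B\<close> are glued along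
  \<open>X\<close> and the edge.
\<close>

lemma menger:
  assumes "finite r" "finite A" "\<And>X. finite X \<Longrightarrow> separates r A B X \<Longrightarrow> k \<le> card X"
  obtains P where "finite P" "card P = k" "disjoint_paths r A B P"
proof -
  have "\<exists>P. finite P \<and> card P = k \<and> disjoint_paths r A B P"
    using assms
  proof (induction r arbitrary: A B rule: finite_induct)
    case empty
    \<comment> \<open>Without pairs a walk is a single vertex, so \<open>A \<inter> B\<close>
      separates.\<close>
    have "p = [hd p]" if "walk {} A B p" for p
      using that by (cases p rule: list.exhaust; cases "tl p") (auto simp: walk_def)
    then have "separates {} A B (A \<inter> B)"
      unfolding separates_def walk_def by (metis IntI disjoint_iff last.simps list.set_sel(1))
    then have "k \<le> card (A \<inter> B)"
      using empty by simp
    then obtain Y where Y: "Y \<subseteq> A \<inter> B" "card Y = k" "finite Y"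
      by (meson obtain_subset_with_card_n)
    have "card ((\<lambda>a. [a]) ` Y) = k"
      using Y by (subst card_image) (auto simp: inj_on_def)
    moreover have "disjoint_paths {} A B ((\<lambda>a. [a]) ` Y)"
      using Y by (auto simp: disjoint_paths_def walk_def)
    ultimately show ?case using Y by blast
  next
    case (insert e r)
    obtain x y where e: "e = (x, y)" by (cases e)
    show ?case
    proof (cases "\<forall>X. finite X \<longrightarrow> separates r A B X \<longrightarrow> k \<le> card X")
      case True
      then obtain P where "finite P" "card P = k" "disjoint_paths r A B P"
        using insert.IH[of A B] insert.prems(1) by blast
      moreover from this have "disjoint_paths (insert e r) A B P"
        by (auto simp: disjoint_paths_def intro: walk_mono)
      ultimately show ?thesis by blast
    next
      case False
      then obtain X where X: "finite X" "separates r A B X" "card X < k" by force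
      \<comment> \<open>Adding either end of the deleted edge turns \<open>X\<close> into a
        separator for the larger relation. Hence \<open>X\<close> has exactly \<open>k - 1\<close>
        elements and contains neither end.\<close>
      have "k \<le> card (insert x X)" "k \<le> card (insert y X)"
        using insert.prems(2)[of "insert x X"] insert.prems(2)[of "insert y X"] X
          separates_insert_source[OF X(2)] separates_insert_target[OF X(2)] by (auto simp: e)
      then have xy: "x \<notin> X" "y \<notin> X" "card (insert x X) = k" "card (insert y X) = k"
        using X by (auto simp: card_insert_if split: if_splits)
      obtain P where P: "finite P" "card P = k" "disjoint_paths r A (insert x X) P"
        using insert.IH[of A "insert x X"] insert.prems separates_extend_source[OF X(2)]
        by (auto simp: e)
      obtain Q where Q: "finite Q" "card Q = k" "disjoint_paths r (insert y X) B Q"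
        using insert.IH[of "insert y X" B] insert.prems X(1) separates_extend_target[OF X(2)]
        by (auto simp: e)
      obtain f where f: "\<And>s. s \<in> insert x X \<Longrightarrow> f s \<in> P" "\<And>s. s \<in> insert x X \<Longrightarrow> last (f s) = s"
        "\<And>s. s \<in> insert x X \<Longrightarrow> set (f s) \<inter> insert x X = {s}"
        by (rule disjoint_transversal[of "insert x X" P last])
          (use X P xy in \<open>auto simp: disjoint_paths_def walk_def\<close>)
      obtain g where g: "\<And>s. s \<in> insert y X \<Longrightarrow> g s \<in> Q" "\<And>s. s \<in> insert y X \<Longrightarrow> hd (g s) = s"
        "\<And>s. s \<in> insert y X \<Longrightarrow> set (g s) \<inter> insert y X = {s}"
        by (rule disjoint_transversal[of "insert y X" Q hd])
          (use X Q xy in \<open>auto simp: disjoint_paths_def walk_def\<close>)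
      have wf: "walk r A (insert x X) (f s)" "distinct (f s)" if "s \<in> insert x X" for s
        using f(1)[OF that] P by (auto simp: disjoint_paths_def)
      have wg: "walk r (insert y X) B (g s)" "distinct (g s)" if "s \<in> insert y X" for s
        using g(1)[OF that] Q by (auto simp: disjoint_paths_def)
      \<comment> \<open>Following \<open>f s\<close> up to \<open>v\<close> and then
        \<open>g t\<close> gives a walk in \<open>r\<close> from \<open>A\<close> to
        \<open>B\<close>, which must meet \<open>X\<close>. Neither half meets \<open>X\<close> away
        from its own end, so the meeting point is \<open>v\<close>.\<close>
      have cross: "v = s \<and> v = t \<and> v \<in> X"
        if st: "s \<in> insert x X" "t \<in> insert y X" and v: "v \<in> set (f s)" "v \<in> set (g t)" for s t v
      proof -
        obtain us vs where fs: "f s = us @ v # vs" using v(1) by (auto simp: in_set_conv_decomp)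
        obtain us' vs' where gt: "g t = us' @ v # vs'" using v(2) by (auto simp: in_set_conv_decomp)
        have "walk r A B (us @ v # vs')"
          using wf[OF st(1)] wg[OF st(2)] unfolding fs gt
          by (auto simp: walk_def successively_append_iff hd_append split: if_splits)
        then obtain z where z: "z \<in> X" "z \<in> set us \<or> z = v \<or> z \<in> set vs'"
          using X(2) by (fastforce simp: separates_def)
        have "z \<notin> set us"
        proof
          assume "z \<in> set us"
          then have "z = last (f s)" using z f(2,3)[OF st(1)] fs by auto
          moreover have "last (f s) \<in> set (v # vs)" by (simp add: fs)
          ultimately show False using \<open>z \<in> set us\<close> wf(2)[OF st(1)] by (auto simp: fs)
        qed
        moreover have "z \<notin> set vs'"
        proof
          assume "z \<in> set vs'"
          then have "z = hd (g t)" using z g(2,3)[OF st(2)] gt by auto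
          moreover have "hd (g t) \<in> set (us' @ [v])" by (cases us') (simp_all add: gt)
          ultimately show False using \<open>z \<in> set vs'\<close> wg(2)[OF st(2)] by (auto simp: gt)
        qed
        ultimately have "v \<in> X" using z by auto
        then show ?thesis using f(3)[OF st(1)] g(3)[OF st(2)] v by auto
      qed
      \<comment> \<open>The path ending in \<open>x\<close> crosses the new edge to
        \<open>g y\<close>. Any other path continues at the shared vertex \<open>s\<close>, whose
        second copy \<open>tl\<close> removes.\<close>
      define R where "R s = (if s = x then f x @ g y else f s @ tl (g s))" for s
      have R: "walk (insert e r) A B (R s)" "distinct (R s)" if s: "s \<in> insert x X" for s
      proof -
        have "walk (insert e r) A B (R s) \<and> distinct (R s)"
        proof (cases "s = x")
          case True
          have "set (f x) \<inter> set (g y) = {}" using cross[of x y] xy by blast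
          moreover have "walk (insert e r) A (insert x X) (f x)" "walk (insert e r) (insert y X) B (g y)"
            using wf[of x] wg[of y] by (auto intro: walk_mono)
          ultimately show ?thesis
            using True wf(2)[of x] wg(2)[of y] f(2)[of x] g(2)[of y]
            by (auto simp: R_def walk_def successively_append_iff e)
        next
          case False
          then have "s \<in> X" using s by simp
          obtain vs where vs: "g s = s # vs"
            using wg(1)[of s] g(2)[of s] \<open>s \<in> X\<close> by (cases "g s") (auto simp: walk_def)
          have "set (f s) \<inter> set vs = {}"
            using cross[of s s] wg(2)[of s] \<open>s \<in> X\<close> by (auto simp: vs)
          moreover have "walk (insert e r) A (insert x X) (f s)" "walk (insert e r) (insert y X) B (s # vs)"
            using wf(1)[of s] wg(1)[of s] \<open>s \<in> X\<close> by (auto intro: walk_mono simp: vs)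
          ultimately show ?thesis
            using False wf(2)[of s] wg(2)[of s] f(2)[of s] \<open>s \<in> X\<close>
            by (auto simp: R_def walk_def successively_append_iff successively_Cons last_append vs split: if_splits)
        qed
        then show "walk (insert e r) A B (R s)" "distinct (R s)" by auto
      qed
      have fd: "set (f s) \<inter> set (f t) = {}" if "s \<in> insert x X" "t \<in> insert x X" "s \<noteq> t" for s t
        using P(3) f(1,2)[OF that(1)] f(1,2)[OF that(2)] that(3) unfolding disjoint_paths_def by metis
      have gd: "set (g s) \<inter> set (g t) = {}" if "s \<in> insert y X" "t \<in> insert y X" "s \<noteq> t" for s t
        using Q(3) g(1,2)[OF that(1)] g(1,2)[OF that(2)] that(3) unfolding disjoint_paths_def by metis
      \<comment> \<open>\<open>h s\<close> is the vertex at which the second half of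
        \<open>R s\<close> starts.\<close>
      define h where "h s = (if s = x then y else s)" for s
      have h: "h s \<in> insert y X" if "s \<in> insert x X" for s
        using that by (auto simp: h_def)
      have hinj: "h s \<noteq> h t" if "s \<in> insert x X" "t \<in> insert x X" "s \<noteq> t" for s t
        using that xy by (auto simp: h_def)
      have setR: "set (R s) \<subseteq> set (f s) \<union> set (g (h s))" for s
        by (auto simp: R_def h_def dest: list.set_sel(2)[rotated]) (metis list.set_sel(2) tl_Nil)
      have Rd: "set (R s) \<inter> set (R t) = {}" if st: "s \<in> insert x X" "t \<in> insert x X" "s \<noteq> t" for s t
      proof -
        have "set (f s) \<inter> set (g (h t)) = {}" "set (f t) \<inter> set (g (h s)) = {}"
          using cross[OF st(1) h[OF st(2)]] cross[OF st(2) h[OF st(1)]] xy st(3)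
          unfolding disjoint_iff h_def by metis+
        then show ?thesis
          using fd[OF st] gd[OF h[OF st(1)] h[OF st(2)] hinj[OF st]] setR[of s] setR[of t] by blast
      qed
      have "inj_on R (insert x X)"
      proof (rule inj_onI, rule ccontr)
        fix s t assume st: "s \<in> insert x X" "t \<in> insert x X" "R s = R t" "s \<noteq> t"
        then have "set (R s) = {}" using Rd[of s t] by auto
        then show False using R(1)[OF st(1)] by (simp add: walk_def)
      qed
      then have "card (R ` insert x X) = k" using xy by (metis card_image)
      moreover have "disjoint_paths (insert e r) A B (R ` insert x X)"
        unfolding disjoint_paths_def using R Rd by blast
      ultimately show ?thesis using X(1) by (intro exI[of _ "R ` insert x X"]) simp
    qed
  qed
  then show thesis using that by blast
qed

section \<open>Two-vertex packings from generalised 3-connectivity\<close>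

text \<open>The walk is cut after its last visit to \<open>u\<close>.\<close>

lemma rtranclp_last_departure:
  assumes "r\<^sup>*\<^sup>* u v" "u \<noteq> v"
  obtains a where "r u a" "a \<noteq> u" "(\<lambda>x y. r x y \<and> x \<noteq> u \<and> y \<noteq> u)\<^sup>*\<^sup>* a v"
proof -
  have "v \<noteq> u \<longrightarrow> (\<exists>a. r u a \<and> a \<noteq> u \<and> (\<lambda>x y. r x y \<and> x \<noteq> u \<and> y \<noteq> u)\<^sup>*\<^sup>* a v)"
    using assms(1)
  proof induction
    case (step y z)
    show ?case
    proof (cases "y = u \<or> z = u")
      case True
      then show ?thesis using step.hyps(2) by blast
    next
      case False
      then obtain a where a: "r u a" "a \<noteq> u" "(\<lambda>x y. r x y \<and> x \<noteq> u \<and> y \<noteq> u)\<^sup>*\<^sup>* a y"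
        using step.IH by blast
      have "(\<lambda>x y. r x y \<and> x \<noteq> u \<and> y \<noteq> u)\<^sup>*\<^sup>* a z"
        using a(3) by (rule rtranclp.rtrancl_into_rtrancl) (use step.hyps False in simp)
      then show ?thesis using a by blast
    qed
  qed simp
  then show thesis using that assms(2) by blast
qed

text \<open>The walk is cut at its first visit to \<open>v\<close>.\<close>

lemma rtranclp_first_arrival:
  assumes "r\<^sup>*\<^sup>* u v" "u \<noteq> v"
  obtains b where "r b v" "b \<noteq> v" "(\<lambda>x y. r x y \<and> x \<noteq> v \<and> y \<noteq> v)\<^sup>*\<^sup>* u b"
proof -
  have "u \<noteq> v \<longrightarrow> (\<exists>b. r b v \<and> b \<noteq> v \<and> (\<lambda>x y. r x y \<and> x \<noteq> v \<and> y \<noteq> v)\<^sup>*\<^sup>* u b)"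
    using assms(1)
  proof (induction rule: converse_rtranclp_induct)
    case (step y z)
    show ?case
    proof (cases "y = v \<or> z = v")
      case True
      then show ?thesis using step.hyps(1) by blast
    next
      case False
      then obtain b where b: "r b v" "b \<noteq> v" "(\<lambda>x y. r x y \<and> x \<noteq> v \<and> y \<noteq> v)\<^sup>*\<^sup>* z b"
        using step.IH by blast
      have "(\<lambda>x y. r x y \<and> x \<noteq> v \<and> y \<noteq> v)\<^sup>*\<^sup>* y b"
        by (rule converse_rtranclp_into_rtranclp[OF _ b(3)]) (use step.hyps False in simp)
      then show ?thesis using b by blast
    qed
  qed simp
  then show thesis using that assms(2) by blast
qed

text \<open>The last clause keeps what a step says about its target, such as avoiding a separator,
  available for every vertex other than the start.\<close>

lemma rtranclp_imp_successively:
  assumes "r\<^sup>*\<^sup>* a b"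
  obtains p where "p \<noteq> []" "hd p = a" "last p = b" "successively r p"
    "\<forall>x\<in>set p. x = a \<or> (\<exists>y. r y x)"
proof -
  have "\<exists>p. p \<noteq> [] \<and> hd p = a \<and> last p = b \<and> successively r p \<and> (\<forall>x\<in>set p. x = a \<or> (\<exists>y. r y x))"
    using assms
  proof induction
    case base
    then show ?case by (intro exI[of _ "[a]"]) simp
  next
    case (step y z)
    then obtain p where "p \<noteq> []" "hd p = a" "last p = y" "successively r p"
      "\<forall>x\<in>set p. x = a \<or> (\<exists>y. r y x)" by blast
    with step show ?case
      by (intro exI[of _ "p @ [z]"]) (auto simp: successively_append_iff)
  qed
  then show thesis using that by blast
qed

lemma kappa_le_kappa_set:
  assumes "connected_graph G" "S \<subseteq> verts G" "card S = k"
  shows "kappa k G \<le> kappa_set G S"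
proof -
  have fin: "finite (verts G)" using assms(1) by (simp add: connected_graph_def simple_graph_def)
  have "{kappa_set G S | S. S \<subseteq> verts G \<and> card S = k} \<subseteq> kappa_set G ` Pow (verts G)" by auto
  then have "finite {kappa_set G S | S. S \<subseteq> verts G \<and> card S = k}"
    using fin by (meson finite_Pow_iff finite_imageI finite_subset)
  moreover have "\<not> card (verts G) < k" using card_mono[OF fin assms(2)] assms(3) by simp
  ultimately show ?thesis using assms by (auto simp: kappa_def intro!: Min_le)
qed

lemma kappa_packing:
  assumes "connected_graph (G :: 'a ugraph)" "S \<subseteq> verts G" "card S = k"
  obtains I :: "'a ugraph set" and W F where "finite I" "card I = kappa k G" "packing G S I W F"
proof -
  have "simple_graph G" using assms by (simp add: connected_graph_def)
  then obtain I :: "'a ugraph set" and W F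
    where I: "finite I" "card I = kappa_set G S" "packing G S I W F"
    by (rule kappa_set_packing)
  then obtain J where "J \<subseteq> I" "card J = kappa k G"
    using kappa_le_kappa_set[OF assms] by (metis obtain_subset_with_card_n)
  then show thesis
    using that I packing_mono finite_subset by metis
qed

lemma joins_imp_link:
  assumes "joins G S W F" "s \<in> S" "t \<in> S" "s \<noteq> t"
  obtains x where "link G S W F s x"
  using assms unfolding joins_def by (metis converse_rtranclpE)

text \<open>Choosing a point of \<open>X\<close> in each set is injective. This bounds how many
  connectors a vertex set can hit.\<close>

lemma disjoint_meeting_card_le:
  assumes "finite X" "\<forall>i\<in>I. W i \<inter> X \<noteq> {}" "\<forall>i\<in>I. \<forall>j\<in>I. i \<noteq> j \<longrightarrow> W i \<inter> W j \<inter> X = {}"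
  shows "finite I" "card I \<le> card X"
proof -
  obtain f where f: "\<forall>i\<in>I. f i \<in> W i \<inter> X"
    using bchoice[of I "\<lambda>i y. y \<in> W i \<inter> X"] assms(2) by blast
  then have "inj_on f I"
    using assms(3) by (intro inj_onI) (metis IntD1 IntD2 IntI empty_iff)
  moreover have "f ` I \<subseteq> X" using f by blast
  ultimately show "finite I" "card I \<le> card X"
    using assms(1) by (auto intro: inj_on_finite card_inj_on_le)
qed

text \<open>A connector without inner vertices needs two of the three edges of the triangle on
  \<open>S\<close>, and two such pairs of edges overlap, so there is at most one. Every other
  connector owns one of the vertices outside \<open>S\<close>.\<close>

lemma packing_card_le:
  assumes G: "simple_graph G" and S: "S \<subseteq> verts G" "card S = 3"
    and P: "packing G S I W F" and I: "finite I"
  shows "card I + 2 \<le> card (verts G)"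
proof -
  have fin: "finite (verts G)" using G by (simp add: simple_graph_def)
  obtain a b c where abc: "S = {a, b, c}" "a \<noteq> b" "a \<noteq> c" "b \<noteq> c"
    using S(2) by (auto simp: card_3_iff)
  let ?J = "{i \<in> I. W i \<inter> verts G \<subseteq> S}" and ?K = "{i \<in> I. W i \<inter> (verts G - S) \<noteq> {}}"
  have inner: "\<exists>t\<in>S. t \<noteq> s \<and> {s, t} \<in> F i" if i: "i \<in> ?J" and s: "s \<in> S" for i s
  proof -
    obtain t where t: "t \<in> S" "t \<noteq> s" using abc that by auto
    have "joins G S (W i) (F i)" using P that by (simp add: packing_def)
    then obtain x where x: "link G S (W i) (F i) s x"
      using joins_imp_link[OF _ s t(1)] t(2) by metis
    then have "x \<in> S" "x \<noteq> s"
      using that simple_graph_edgeD[OF G, of s x] by (auto simp: link_def)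
    then show ?thesis using x that by (auto simp: link_def)
  qed
  have two: "({a, b} \<in> F i \<or> {a, c} \<in> F i) \<and> ({a, b} \<in> F i \<or> {b, c} \<in> F i) \<and>
      ({a, c} \<in> F i \<or> {b, c} \<in> F i)" if "i \<in> ?J" for i
    using inner[OF that, of a] inner[OF that, of b] inner[OF that, of c] abc
    by (auto simp: insert_commute)
  have "i = j" if "i \<in> ?J" "j \<in> ?J" for i j
  proof (rule ccontr)
    assume "i \<noteq> j"
    then have "F i \<inter> F j = {}" using P that by (auto simp: packing_def)
    then show False using two[OF that(1)] two[OF that(2)] by blast
  qed
  then have "card ?J \<le> 1"
    using I by (auto simp: card_le_Suc0_iff_eq)
  moreover have "card ?K \<le> card (verts G - S)"
    by (rule disjoint_meeting_card_le(2)[where W = W]) (use fin P in \<open>auto simp: packing_def\<close>)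
  moreover have "card I \<le> card ?J + card ?K"
  proof -
    have "I = ?J \<union> ?K" by auto
    then have "card I = card (?J \<union> ?K)" by (rule arg_cong)
    then show ?thesis using card_Un_le[of ?J ?K] by linarith
  qed
  moreover have "card (verts G - S) + 3 = card (verts G)"
    using S fin card_mono[OF fin S(1)] by (simp add: card_Diff_subset finite_subset)
  ultimately show ?thesis by linarith
qed

text \<open>In a packing on \<open>u\<close>, \<open>v\<close> and a third terminal, each vertex of
  \<open>X\<close> spoils at most one connector, and so does the edge between \<open>u\<close> and
  \<open>v\<close>. With fewer obstacles than connectors, one survives and supplies the
  walk.\<close>

lemma kappa_3_separation:
  fixes G :: "'a ugraph"
  assumes G: "connected_graph G" and V: "card (verts G) \<ge> 3" and uv: "u \<in> verts G" "v \<in> verts G" "u \<noteq> v"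
    and X: "finite X" "card X + (if {u, v} \<in> edges G then 1 else 0) < kappa 3 G"
  obtains a b where "{u, a} \<in> edges G" "{b, v} \<in> edges G"
    "a \<notin> {u, v} \<union> X" "b \<notin> {u, v} \<union> X"
    "(\<lambda>x y. {x, y} \<in> edges G \<and> x \<notin> {u, v} \<union> X \<and> y \<notin> {u, v} \<union> X)\<^sup>*\<^sup>* a b"
proof -
  have simple: "simple_graph G" and fin: "finite (verts G)"
    using G by (auto simp: connected_graph_def simple_graph_def)
  obtain S0 where S0: "S0 \<subseteq> verts G" "card S0 = 3"
    using V by (metis obtain_subset_with_card_n)
  \<comment> \<open>This bound shows that \<open>X\<close>, \<open>u\<close> and \<open>v\<close> do
    not exhaust the graph, so a third terminal outside \<open>X\<close> exists.\<close>
  have "kappa 3 G + 2 \<le> card (verts G)"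
    using kappa_packing[OF G S0] packing_card_le[OF simple S0] by metis
  moreover have "card (X \<union> {u, v}) \<le> card X + 2"
    using card_Un_le[of X "{u, v}"] uv by simp
  ultimately have "\<not> verts G \<subseteq> X \<union> {u, v}"
    using X card_mono[of "X \<union> {u, v}" "verts G"] by auto
  then obtain w where w: "w \<in> verts G" "w \<notin> X" "w \<noteq> u" "w \<noteq> v" by blast
  let ?S = "{u, v, w}"
  have "?S \<subseteq> verts G" "card ?S = 3" using uv w by auto
  from kappa_packing[OF G this]
  obtain I :: "'a ugraph set" and W F where I: "finite I" "card I = kappa 3 G" and P: "packing G ?S I W F"
    by metis
  let ?J = "{i \<in> I. W i \<inter> (X - ?S) \<noteq> {}}" and ?K = "{i \<in> I. {u, v} \<in> edges G \<and> {u, v} \<in> F i}"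
  have "card ?J \<le> card (X - ?S)"
    by (rule disjoint_meeting_card_le(2)[where W = W]) (use X P in \<open>auto simp: packing_def\<close>)
  also have "\<dots> \<le> card X" using X by (simp add: card_mono)
  finally have J: "card ?J \<le> card X" .
  have K: "card ?K \<le> (if {u, v} \<in> edges G then 1 else 0)"
  proof -
    have "i = j" if "i \<in> ?K" "j \<in> ?K" for i j
      using P that unfolding packing_def by blast
    then show ?thesis using I(1) by (auto simp: card_le_Suc0_iff_eq)
  qed
  have "card (?J \<union> ?K) < card I"
    using card_Un_le[of ?J ?K] J K X I by linarith
  then have "\<not> I \<subseteq> ?J \<union> ?K"
    using card_mono[of "?J \<union> ?K" I] I(1) by auto
  then obtain i where "i \<in> I" "i \<notin> ?J" "i \<notin> ?K" by blast
  then have i: "i \<in> I" "W i \<inter> X \<subseteq> ?S" "{u, v} \<in> edges G \<Longrightarrow> {u, v} \<notin> F i"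
    by blast+
  let ?r = "link G ?S (W i) (F i)"
  have "?r\<^sup>*\<^sup>* u v" using P i(1) by (auto simp: packing_def joins_def)
  then obtain a where a: "?r u a" "a \<noteq> u" "(\<lambda>x y. ?r x y \<and> x \<noteq> u \<and> y \<noteq> u)\<^sup>*\<^sup>* a v"
    using uv(3) by (rule rtranclp_last_departure)
  have "\<not> ?r u v" using i(3) by (auto simp: link_def)
  then have "a \<noteq> v" using a(1) by blast
  with a(3) obtain b where b: "?r b v" "b \<noteq> u" "b \<noteq> v"
    "(\<lambda>x y. (?r x y \<and> x \<noteq> u \<and> y \<noteq> u) \<and> x \<noteq> v \<and> y \<noteq> v)\<^sup>*\<^sup>* a b"
    by (rule rtranclp_first_arrival) auto
  have out: "x \<notin> {u, v} \<union> X" if "x \<in> ?S \<union> W i" "x \<noteq> u" "x \<noteq> v" for x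
    using that i(2) w by auto
  show thesis
  proof (rule that)
    show "{u, a} \<in> edges G" "{b, v} \<in> edges G"
      using a b by (auto simp: link_def)
    show "a \<notin> {u, v} \<union> X" "b \<notin> {u, v} \<union> X"
      using a(1,2) b(1-3) \<open>a \<noteq> v\<close> out[of a] out[of b] unfolding link_def by blast+
    show "(\<lambda>x y. {x, y} \<in> edges G \<and> x \<notin> {u, v} \<union> X \<and> y \<notin> {u, v} \<union> X)\<^sup>*\<^sup>* a b"
      by (rule mono_rtranclp[THEN mp, OF _ b(4)]) (use out in \<open>auto simp: link_def\<close>)
  qed
qed

text \<open>Menger's theorem is applied between the neighbourhoods of \<open>u\<close> and
  \<open>v\<close> in the graph without these two vertices. An edge between them is a connector by
  itself and lowers the number of paths needed by one.\<close>

lemma kappa_3_two_vertex_packing: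
  fixes G :: "'a ugraph"
  assumes G: "connected_graph G" and uv: "u \<in> verts G" "v \<in> verts G" "u \<noteq> v"
  obtains I :: "'a list set" and W F
  where "finite I" "kappa 3 G \<le> card I" "packing G {u, v} I W F"
proof (cases "card (verts G) < 3")
  case True
  have simple: "simple_graph G" and fin: "finite (verts G)"
    using G by (auto simp: connected_graph_def simple_graph_def)
  \<comment> \<open>With fewer than three vertices \<open>kappa 3 G\<close> is 1 by convention, and
    the single edge suffices.\<close>
  have "verts G = {u, v}"
    using True uv card_seteq[of "verts G" "{u, v}"] fin by simp
  moreover have "(adj G)\<^sup>*\<^sup>* u v" using G uv by (simp add: connected_graph_def)
  then obtain x where "adj G u x" using uv(3) by (metis converse_rtranclpE)
  ultimately have "adj G u v"
    using simple_graph_edgeD[OF simple, of u x] by (auto simp: adj_def)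
  then have "link G {u, v} {} {{u, v}} u v"
    by (simp add: link_def adj_def)
  then have "joins G {u, v} {} {{u, v}}"
    by (intro joinsI[of _ _ _ _ u]) auto
  then have "packing G {u, v} {[] :: 'a list} (\<lambda>_. {}) (\<lambda>_. {{u, v}})"
    by (simp add: packing_def)
  then show thesis
    using that[of "{[]}"] True G by (simp add: kappa_def)
next
  case False
  have simple: "simple_graph G" and fin: "finite (verts G)"
    using G by (auto simp: connected_graph_def simple_graph_def)
  define A where "A = {a. {u, a} \<in> edges G \<and> a \<notin> {u, v}}"
  define B where "B = {b. {b, v} \<in> edges G \<and> b \<notin> {u, v}}"
  define r where "r = {(x, y). {x, y} \<in> edges G \<and> x \<notin> {u, v} \<and> y \<notin> {u, v}}"
  define d :: nat where "d = (if {u, v} \<in> edges G then 1 else 0)"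
  have "finite r"
    by (rule finite_subset[of _ "verts G \<times> verts G"])
      (use fin simple_graph_edgeD[OF simple] in \<open>auto simp: r_def\<close>)
  moreover have "finite A"
    by (rule finite_subset[OF _ fin]) (use simple_graph_edgeD[OF simple] in \<open>auto simp: A_def\<close>)
  moreover have "kappa 3 G - d \<le> card X" if X: "finite X" "separates r A B X" for X
  proof (rule ccontr)
    assume "\<not> kappa 3 G - d \<le> card X"
    then have "card X + (if {u, v} \<in> edges G then 1 else 0) < kappa 3 G"
      by (simp add: d_def split: if_splits)
    from kappa_3_separation[OF G _ uv X(1) this] False
    obtain a b where ab: "{u, a} \<in> edges G" "{b, v} \<in> edges G"
      "a \<notin> {u, v} \<union> X" "b \<notin> {u, v} \<union> X"
      and reach: "(\<lambda>x y. {x, y} \<in> edges G \<and> x \<notin> {u, v} \<union> X \<and> y \<notin> {u, v} \<union> X)\<^sup>*\<^sup>* a b"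
      by auto
    obtain p where p: "p \<noteq> []" "hd p = a" "last p = b"
      "successively (\<lambda>x y. {x, y} \<in> edges G \<and> x \<notin> {u, v} \<union> X \<and> y \<notin> {u, v} \<union> X) p"
      "\<forall>x\<in>set p. x = a \<or> (\<exists>y. {y, x} \<in> edges G \<and> y \<notin> {u, v} \<union> X \<and> x \<notin> {u, v} \<union> X)"
      by (rule rtranclp_imp_successively[OF reach])
    have "successively (\<lambda>x y. (x, y) \<in> r) p"
      using p(4) by (rule successively_mono) (auto simp: r_def)
    then have "walk r A B p"
      using p ab by (auto simp: walk_def A_def B_def)
    then obtain x where "x \<in> set p" "x \<in> X" using X(2) by (auto simp: separates_def)
    then show False using bspec[OF p(5)] ab(3) by auto
  qed
  ultimately obtain P where P: "finite P" "card P = kappa 3 G - d" "disjoint_paths r A B P"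
    by (rule menger)
  \<comment> \<open>Paths index themselves. The empty list is never a walk, so it is free to index
    the edge between \<open>u\<close> and \<open>v\<close>.\<close>
  define I where "I = (if {u, v} \<in> edges G then insert [] P else P)"
  define F where "F p = (if p = [] then {{u, v}} else {})" for p :: "'a list"
  have ne: "[] \<notin> P" using P(3) by (auto simp: disjoint_paths_def walk_def)
  have "joins G {u, v} (set p) (F p)" if "p \<in> I" for p
  proof (cases "p = []")
    case True
    then have "link G {u, v} (set p) (F p) u v"
      using that ne by (auto simp: I_def F_def link_def split: if_splits)
    then show ?thesis by (intro joinsI[of _ _ _ _ u]) auto
  next
    case False
    let ?r = "link G {u, v} (set p) (F p)"
    have p: "walk r A B p" using that False P(3) by (auto simp: I_def disjoint_paths_def split: if_splits)
    then have "successively ?r p"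
      unfolding walk_def by (auto simp: r_def link_def elim!: successively_mono)
    then have "?r\<^sup>*\<^sup>* (hd p) (last p)"
      using False successively_imp_rtranclp_last[of ?r "hd p" "tl p"] by simp
    moreover have "?r u (hd p)" "?r (last p) v"
      using p False by (auto simp: walk_def A_def B_def link_def)
    ultimately have "?r\<^sup>*\<^sup>* u v"
      by (meson converse_rtranclp_into_rtranclp rtranclp.rtrancl_into_rtrancl)
    then show ?thesis by (intro joinsI[of _ _ _ _ u]) auto
  qed
  moreover have "set p \<inter> set q \<subseteq> {u, v} \<and> F p \<inter> F q = {}" if "p \<in> I" "q \<in> I" "p \<noteq> q" for p q
    using that P(3) by (auto simp: I_def F_def disjoint_paths_def split: if_splits)
  ultimately have "packing G {u, v} I set F"
    by (simp add: packing_def)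
  moreover have "finite I" "kappa 3 G \<le> card I"
    using P ne by (auto simp: I_def d_def)
  ultimately show thesis using that[of I set F] by simp
qed

section \<open>Packings around three vertices\<close>

text \<open>
  The pairs \<open>(A, F)\<close> that can be multiplied by the order of \<open>H\<close> in the product. Here \<open>A\<close> may contain
  terminals: \<open>c \<in> A\<close> for a terminal \<open>c\<close> means that the fibre over \<open>c\<close> is reserved for this pair.
\<close>

definition liftable :: "'a ugraph \<Rightarrow> 'a set \<Rightarrow> 'a set \<Rightarrow> 'a set set \<Rightarrow> bool" where
  "liftable G S A F \<longleftrightarrow>
     joins G S A {} \<or>
     (\<exists>c e d. S = {c, e, d} \<and> distinct [c, e, d] \<and> c \<in> A \<and> {e, c} \<in> F \<inter> edges G \<and>
        (link G S A {})\<^sup>*\<^sup>* c d) \<or>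
     (\<exists>c e d. S = {c, e, d} \<and> distinct [c, e, d] \<and> c \<in> A \<and> d \<in> A \<and>
        {e, c} \<in> F \<inter> edges G \<and> {c, d} \<in> F \<inter> edges G)"

text \<open>This normalises packings: once the elements without effect are removed, inner parts are
  disjoint outright and permitted edges are genuine edges inside \<open>S\<close>.\<close>

lemma link_restrict:
  "link G S (W - S) (F \<inter> {e \<in> edges G. e \<subseteq> S}) = link G S W F"
  by (auto simp: link_def fun_eq_iff)

lemma packing_restrict:
  assumes "packing G S I W F"
  shows "packing G S I (\<lambda>i. W i - S) (\<lambda>i. F i \<inter> {e \<in> edges G. e \<subseteq> S})"
  using assms unfolding packing_def joins_def link_restrict by blast

lemma link_insert_terminal: "s \<in> S \<Longrightarrow> link G S (insert s W) F = link G S W F"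
  by (auto simp: link_def fun_eq_iff)

text \<open>Before the walk first uses the edge it has reached one of its ends.\<close>

lemma link_single_edge_reach:
  assumes "(link G S W {{x, y}})\<^sup>*\<^sup>* z p"
  shows "(link G S W {})\<^sup>*\<^sup>* z p \<or> (link G S W {})\<^sup>*\<^sup>* z x \<or> (link G S W {})\<^sup>*\<^sup>* z y"
  using assms
proof induction
  case (step p q)
  show ?case
  proof (cases "link G S W {} p q")
    case True
    then show ?thesis using step.IH by (meson rtranclp.rtrancl_into_rtrancl)
  next
    case False
    then have "{p, q} = {x, y}" using step.hyps(2) by (auto simp: link_def)
    then have "p = x \<or> p = y" by (auto simp: doubleton_eq_iff)
    then show ?thesis using step.IH by blast
  qed
qed simp

lemma two_edges_in_triangle:
  assumes "card S = 3" "f \<subseteq> S" "g \<subseteq> S" "card f = 2" "card g = 2" "f \<noteq> g"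
  obtains c e d where "S = {c, e, d}" "distinct [c, e, d]" "f = {e, c}" "g = {c, d}"
proof -
  have fin: "finite S" using assms by (simp add: card_ge_0_finite)
  obtain e c where f: "f = {e, c}" "e \<noteq> c" using assms by (auto simp: card_2_iff)
  obtain p q where g: "g = {p, q}" "p \<noteq> q" using assms by (auto simp: card_2_iff)
  have "card (S - f) = 1" using assms fin by (simp add: card_Diff_subset finite_subset)
  then obtain d where d: "S - f = {d}" by (auto simp: card_1_singleton_iff)
  then have S: "S = {c, e, d}" "d \<noteq> c" "d \<noteq> e" using assms f by auto
  have "g = {c, d} \<or> g = {e, d}"
    using assms(3,6) f g S by (auto simp: insert_commute)
  then show thesis
  proof
    assume "g = {c, d}"
    then show thesis using that[of c e d] S f by auto
  next
    assume "g = {e, d}"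
    then show thesis using that[of e c d] S f by (auto simp: insert_commute)
  qed
qed

text \<open>The cases are no permitted edge, exactly one, and at least two. With one, the third
  terminal reaches an end of it by other links, and \<open>c\<close> is that end. With two,
  \<open>c\<close> is their common vertex.\<close>

lemma joins_cases:
  assumes G: "simple_graph G" and S: "card S = 3" and J: "joins G S W F"
    and F: "F \<subseteq> {e \<in> edges G. e \<subseteq> S}"
  obtains (inner) "joins G S W {}"
  | (single) c e d where "S = {c, e, d}" "distinct [c, e, d]" "F = {{e, c}}"
      "(link G S W {})\<^sup>*\<^sup>* c d"
  | (double) c e d where "S = {c, e, d}" "distinct [c, e, d]" "{e, c} \<in> F" "{c, d} \<in> F"
proof -
  have card2: "card f = 2" if "f \<in> F" for f using that F G by (auto simp: simple_graph_def)
  consider "F = {}" | f where "F = {f}" | f g where "f \<in> F" "g \<in> F" "f \<noteq> g" by blast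
  then show thesis
  proof cases
    case 1
    then show thesis using J inner by simp
  next
    case 2
    obtain x y where f: "f = {x, y}" "x \<noteq> y" using card2[of f] 2 by (auto simp: card_2_iff)
    have fin: "finite S" using S by (simp add: card_ge_0_finite)
    have xy: "x \<in> S" "y \<in> S" using F 2 f by auto
    then have "card (S - {x, y}) = 1" using S f fin by (simp add: card_Diff_subset)
    then obtain z where z: "S - {x, y} = {z}" by (auto simp: card_1_singleton_iff)
    then have S3: "S = {x, y, z}" "z \<noteq> x" "z \<noteq> y" using xy by auto
    have "(link G S W {{x, y}})\<^sup>*\<^sup>* z x" using J 2 f S3 by (simp add: joins_def)
    from link_single_edge_reach[OF this]
    consider "(link G S W {})\<^sup>*\<^sup>* z x" | "(link G S W {})\<^sup>*\<^sup>* z y" by blast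
    then show thesis
    proof cases
      case 1
      then show thesis
        using single[of x y z, OF _ _ _ link_rtranclp_sym[OF 1]] 2 S3 f by (auto simp: insert_commute)
    next
      case c2: 2
      then show thesis
        using single[of y x z, OF _ _ _ link_rtranclp_sym[OF c2]] 2 S3 f by (auto simp: insert_commute)
    qed
  next
    case 3
    have "f \<subseteq> S" "g \<subseteq> S" using 3 F by auto
    from two_edges_in_triangle[OF S this card2[OF 3(1)] card2[OF 3(2)] 3(3)]
    obtain c e d where "S = {c, e, d}" "distinct [c, e, d]" "f = {e, c}" "g = {c, d}" .
    then show thesis using double[of c e d] 3 by simp
  qed
qed

lemma liftable_inner: "joins G S A {} \<Longrightarrow> liftable G S A F"
  by (simp add: liftable_def)

lemma liftable_single:
  assumes "S = {c, e, d}" "distinct [c, e, d]" "{e, c} \<in> F" "{e, c} \<in> edges G" "(link G S W {})\<^sup>*\<^sup>* c d"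
  shows "liftable G S (insert c W) F"
proof -
  have "link G S (insert c W) {} = link G S W {}"
    using assms(1) by (intro link_insert_terminal) simp
  then show ?thesis using assms unfolding liftable_def by auto
qed

lemma liftable_double:
  assumes "S = {c, e, d}" "distinct [c, e, d]" "c \<in> A" "d \<in> A"
    "{e, c} \<in> F" "{e, c} \<in> edges G" "{c, d} \<in> F" "{c, d} \<in> edges G"
  shows "liftable G S A F"
  unfolding liftable_def using assms by blast

text \<open>The edges at \<open>c\<close> belong to \<open>i0\<close>, so another connector that
  needs an edge has only \<open>{e, d}\<close>; there is at most one of these. It reserves the fibre
  over \<open>e\<close> or \<open>d\<close>, and \<open>i0\<close> reserves the fibre over
  \<open>c\<close> and the remaining one.\<close>

lemma liftable_packing_of_double:
  assumes G: "simple_graph G" and S: "card S = 3" and P: "packing G S I W F"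
    and inner: "\<And>i. i \<in> I \<Longrightarrow> W i \<inter> S = {} \<and> F i \<subseteq> {e \<in> edges G. e \<subseteq> S}"
    and i0: "i0 \<in> I" and ced: "S = {c, e, d}" "distinct [c, e, d]" "{e, c} \<in> F i0" "{c, d} \<in> F i0"
  obtains A where "\<And>i. i \<in> I \<Longrightarrow> liftable G S (A i) (F i)"
    "\<And>i j. i \<in> I \<Longrightarrow> j \<in> I \<Longrightarrow> i \<noteq> j \<Longrightarrow> A i \<inter> A j = {}"
proof -
  let ?N = "{i \<in> I. i \<noteq> i0 \<and> \<not> joins G S (W i) {}}"
  have disj: "F i \<inter> F j = {}" "W i \<inter> W j = {}" if "i \<in> I" "j \<in> I" "i \<noteq> j" for i j
    using P inner that unfolding packing_def by blast+
  have N: "F i = {{e, d}} \<and> ((link G S (W i) {})\<^sup>*\<^sup>* e c \<or> (link G S (W i) {})\<^sup>*\<^sup>* d c)"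
    if i: "i \<in> ?N" for i
  proof -
    have J: "joins G S (W i) (F i)" using P i by (simp add: packing_def)
    have F: "F i \<subseteq> {e \<in> edges G. e \<subseteq> S}" using inner i by simp
    have notin: "{e, c} \<notin> F i" "{c, d} \<notin> F i" using disj(1)[of i i0] i i0 ced by auto
    have tri: "{p, q} = {e, d}" if pq: "p \<in> S" "q \<in> S" "p \<noteq> q" "{p, q} \<in> F i" for p q
    proof -
      have "{p, q} \<noteq> {e, c}" "{p, q} \<noteq> {c, d}" using notin pq(4) by auto
      then show ?thesis using pq(1-3) ced(1) by (auto simp: doubleton_eq_iff)
    qed
    show ?thesis
      using G S J F
    proof (cases rule: joins_cases)
      case inner
      then show ?thesis using i by simp
    next
      case (single c' e' d')
      have "{e', c'} = {e, d}" using tri[of e' c'] single(1-3) by auto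
      moreover from this have "c' = e \<or> c' = d" by (auto simp: doubleton_eq_iff)
      moreover have "d' = c"
      proof -
        have "c \<in> {c', e', d'}" using single(1) ced(1) by auto
        moreover have "c \<notin> {e', c'}" using \<open>{e', c'} = {e, d}\<close> ced(2) by auto
        ultimately show ?thesis by blast
      qed
      ultimately show ?thesis using single(3,4) by auto
    next
      case (double c' e' d')
      have "{e', c'} = {e, d}" "{c', d'} = {e, d}"
        using tri[of e' c'] tri[of c' d'] double by auto
      then have "{e', c'} = {c', d'}" by simp
      then show ?thesis using double(2) by (auto simp: doubleton_eq_iff)
    qed
  qed
  have uniq: "i = j" if "i \<in> ?N" "j \<in> ?N" for i j
    using N[OF that(1)] N[OF that(2)] disj(1)[of i j] that by auto
  obtain x y where xy: "S = {c, x, y}" "distinct [c, x, y]" "{x, c} \<in> F i0" "{c, y} \<in> F i0"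
    and Nx: "\<And>i. i \<in> ?N \<Longrightarrow> F i = {{y, x}} \<and> (link G S (W i) {})\<^sup>*\<^sup>* x c"
  proof (cases "\<exists>i\<in>?N. (link G S (W i) {})\<^sup>*\<^sup>* d c")
    case True
    then have "\<And>i. i \<in> ?N \<Longrightarrow> (link G S (W i) {})\<^sup>*\<^sup>* d c" using uniq by blast
    then show thesis using that[of d e] ced N by (auto simp: insert_commute)
  next
    case False
    then have "\<And>i. i \<in> ?N \<Longrightarrow> (link G S (W i) {})\<^sup>*\<^sup>* e c" using N by blast
    then show thesis using that[of e d] ced N by (auto simp: insert_commute)
  qed
  define A where "A i = (if i = i0 then {c, y} else if i \<in> ?N then insert x (W i) else W i)" for i
  have "liftable G S (A i) (F i)" if i: "i \<in> I" for i
  proof -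
    consider "i = i0" | "i \<in> ?N" | "i \<noteq> i0" "joins G S (W i) {}" using i by blast
    then show ?thesis
    proof cases
      case 1
      have "{x, c} \<in> edges G" "{c, y} \<in> edges G" using inner[OF i0] xy by auto
      then show ?thesis
        using 1 xy liftable_double[of S c x y "{c, y}" "F i0" G] by (simp add: A_def)
    next
      case 2
      have "liftable G S (insert x (W i)) (F i)"
        by (rule liftable_single[of S x y c]) (use xy Nx[OF 2] inner[OF i] in auto)
      then show ?thesis using 2 by (simp add: A_def)
    next
      case 3
      then show ?thesis by (simp add: A_def liftable_inner)
    qed
  qed
  moreover have "A i \<inter> A j = {}" if ij: "i \<in> I" "j \<in> I" "i \<noteq> j" for i j
  proof -
    have "W i \<inter> S = {}" "W j \<inter> S = {}" using inner ij by auto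
    then show ?thesis
      using disj(2)[OF ij] uniq[of i j] ij(3) xy(1,2) by (auto simp: A_def)
  qed
  ultimately show thesis using that by blast
qed

text \<open>If a connector holds two adjacent edges, the previous lemma applies. Otherwise each
  connector that needs an edge has just one and a centre \<open>cen i\<close> to reserve. Distinct
  centres cause no conflict, and a collision is regrouped into a connector with two edges.\<close>

lemma liftable_packing:
  fixes F :: "'i \<Rightarrow> 'a set set"
  assumes G: "simple_graph G" and S: "card S = 3" and P0: "packing G S I W F"
  obtains A and F' :: "'i \<Rightarrow> 'a set set" where "\<And>i. i \<in> I \<Longrightarrow> liftable G S (A i) (F' i)"
    "\<And>i j. i \<in> I \<Longrightarrow> j \<in> I \<Longrightarrow> i \<noteq> j \<Longrightarrow> A i \<inter> A j = {} \<and> F' i \<inter> F' j = {}"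
proof -
  define W1 F1 where "W1 i = W i - S" and "F1 i = F i \<inter> {e \<in> edges G. e \<subseteq> S}" for i
  have P: "packing G S I W1 F1"
    using packing_restrict[OF P0] by (simp add: W1_def[abs_def] F1_def[abs_def])
  have inner: "W1 i \<inter> S = {} \<and> F1 i \<subseteq> {e \<in> edges G. e \<subseteq> S}" for i
    by (auto simp: W1_def F1_def)
  have disj: "F1 i \<inter> F1 j = {}" "W1 i \<inter> W1 j = {}" if "i \<in> I" "j \<in> I" "i \<noteq> j" for i j
    using P inner[of i] that unfolding packing_def by blast+
  show thesis
  proof (cases "\<exists>i\<in>I. \<exists>c e d. S = {c, e, d} \<and> distinct [c, e, d] \<and> {e, c} \<in> F1 i \<and> {c, d} \<in> F1 i")
    case True
    then obtain i0 c e d where *: "i0 \<in> I" "S = {c, e, d}" "distinct [c, e, d]"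
      "{e, c} \<in> F1 i0" "{c, d} \<in> F1 i0" by blast
    obtain A where "\<And>i. i \<in> I \<Longrightarrow> liftable G S (A i) (F1 i)"
      "\<And>i j. i \<in> I \<Longrightarrow> j \<in> I \<Longrightarrow> i \<noteq> j \<Longrightarrow> A i \<inter> A j = {}"
      using liftable_packing_of_double[OF G S P inner *] by metis
    then show thesis using that[of A F1] disj by blast
  next
    case noD: False
    let ?N = "{i \<in> I. \<not> joins G S (W1 i) {}}"
    let ?Q = "\<lambda>i c e d. S = {c, e, d} \<and> distinct [c, e, d] \<and> F1 i = {{e, c}} \<and> (link G S (W1 i) {})\<^sup>*\<^sup>* c d"
    have "\<exists>t. ?Q i (fst t) (fst (snd t)) (snd (snd t))" if i: "i \<in> ?N" for i
    proof -
      have J: "joins G S (W1 i) (F1 i)" using P i by (simp add: packing_def)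
      have F: "F1 i \<subseteq> {e \<in> edges G. e \<subseteq> S}" using inner by simp
      show ?thesis
        using G S J F
      proof (cases rule: joins_cases)
        case inner
        then show ?thesis using i by simp
      next
        case (single c e d)
        then show ?thesis by (intro exI[of _ "(c, e, d)"]) simp
      next
        case (double c e d)
        then show ?thesis using noD i by blast
      qed
    qed
    then have "\<forall>i\<in>?N. \<exists>t. ?Q i (fst t) (fst (snd t)) (snd (snd t))" by blast
    then obtain t where t: "\<forall>i\<in>?N. ?Q i (fst (t i)) (fst (snd (t i))) (snd (snd (t i)))"
      by (rule bchoice[THEN exE])
    define cen oth thi where "cen i = fst (t i)" and "oth i = fst (snd (t i))"
      and "thi i = snd (snd (t i))" for i
    have Q: "?Q i (cen i) (oth i) (thi i)" if "i \<in> ?N" for i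
      using bspec[OF t that] unfolding cen_def oth_def thi_def .
    show thesis
    proof (cases "inj_on cen ?N")
      case True
      define A where "A i = (if i \<in> ?N then insert (cen i) (W1 i) else W1 i)" for i
      have "liftable G S (A i) (F1 i)" if i: "i \<in> I" for i
      proof (cases "i \<in> ?N")
        case True
        have "liftable G S (insert (cen i) (W1 i)) (F1 i)"
          by (rule liftable_single[of S "cen i" "oth i" "thi i"]) (use Q[OF True] inner[of i] in auto)
        then show ?thesis using True by (simp add: A_def)
      next
        case False
        then show ?thesis using i by (simp add: A_def liftable_inner)
      qed
      moreover have "A i \<inter> A j = {}" if ij: "i \<in> I" "j \<in> I" "i \<noteq> j" for i j
      proof -
        have "cen i \<in> S" if "i \<in> ?N" for i using Q[OF that] by blast
        moreover have "cen i \<noteq> cen j" if "i \<in> ?N" "j \<in> ?N" using True ij(3) that by (auto dest: inj_onD)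
        ultimately show ?thesis
          using disj(2)[OF ij] inner[of i] inner[of j] unfolding A_def by auto
      qed
      ultimately show thesis using that[of A F1] disj by blast
    next
      case False
      then obtain i1 i2 where i12: "i1 \<in> ?N" "i2 \<in> ?N" "i1 \<noteq> i2" "cen i1 = cen i2"
        by (auto simp: inj_on_def)
      define c e d where "c = cen i1" and "e = oth i1" and "d = thi i1"
      have 1: "S = {c, e, d}" "distinct [c, e, d]" "F1 i1 = {{e, c}}" "(link G S (W1 i1) {})\<^sup>*\<^sup>* c d"
        using Q[OF i12(1)] by (auto simp: c_def e_def d_def)
      have 2: "S = {c, oth i2, thi i2}" "distinct [c, oth i2, thi i2]" "F1 i2 = {{oth i2, c}}"
        "(link G S (W1 i2) {})\<^sup>*\<^sup>* c (thi i2)"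
        using Q[OF i12(2)] i12(4) by (auto simp: c_def)
      \<comment> \<open>Both edges end in \<open>c\<close>, so disjointness sends them to different
        terminals. Each inner part therefore joins \<open>c\<close> to the far end of the other
        connector's edge.\<close>
      have "F1 i1 \<inter> F1 i2 = {}" using disj(1) i12 by simp
      then have "oth i2 \<noteq> e" using 1 2 by auto
      then have od: "oth i2 = d" "thi i2 = e" using 1 2 by auto
      \<comment> \<open>Both connectors need the fibre over \<open>c\<close>; regroup them.\<close>
      define W2 where "W2 = W1(i1 := W1 i1 \<union> W1 i2, i2 := {})"
      define F2 where "F2 = F1(i1 := {}, i2 := {{e, c}, {c, d}})"
      have edges: "{e, c} \<in> edges G" "{c, d} \<in> edges G"
        using inner[of i1] inner[of i2] 1(3) 2(3) od by (auto simp: insert_commute)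
      have j1: "joins G S (W1 i1 \<union> W1 i2) {}"
      proof (rule joinsI[of _ _ _ _ c])
        fix s assume "s \<in> S"
        moreover have "(link G S (W1 i1 \<union> W1 i2) {})\<^sup>*\<^sup>* c d" "(link G S (W1 i1 \<union> W1 i2) {})\<^sup>*\<^sup>* c e"
          using link_rtranclp_mono[OF 1(4)] link_rtranclp_mono[OF 2(4)] od by auto
        ultimately show "(link G S (W1 i1 \<union> W1 i2) {})\<^sup>*\<^sup>* c s" using 1(1) by auto
      qed
      have j2: "joins G S {} {{e, c}, {c, d}}"
      proof (rule joinsI[of _ _ _ _ c])
        fix s assume "s \<in> S"
        moreover have "link G S {} {{e, c}, {c, d}} c e" "link G S {} {{e, c}, {c, d}} c d"
          using edges 1(1) by (auto simp: link_def insert_commute)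
        ultimately show "(link G S {} {{e, c}, {c, d}})\<^sup>*\<^sup>* c s" using 1(1) by auto
      qed
      have P2: "packing G S I W2 F2"
        unfolding packing_def
      proof (intro conjI ballI impI)
        fix i assume "i \<in> I"
        then show "joins G S (W2 i) (F2 i)"
          using P j1 j2 i12(3) by (simp add: packing_def W2_def F2_def)
      next
        fix i j assume ij: "i \<in> I" "j \<in> I" "i \<noteq> j"
        then show "W2 i \<inter> W2 j \<subseteq> S"
          using disj(2)[of i j] disj(2)[of i1 j] disj(2)[of i2 j] disj(2)[of i i1] disj(2)[of i i2] i12
          by (auto simp: W2_def)
        show "F2 i \<inter> F2 j = {}"
          using ij disj(1)[of i j] disj(1)[of i1 j] disj(1)[of i2 j] disj(1)[of i i1] disj(1)[of i i2] i12 1(3) 2(3) od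
          by (auto simp: F2_def insert_commute)
      qed
      have inner2: "W2 i \<inter> S = {} \<and> F2 i \<subseteq> {e \<in> edges G. e \<subseteq> S}" for i
        using inner[of i] inner[of i1] inner[of i2] edges 1(1) by (auto simp: W2_def F2_def)
      have i2: "i2 \<in> I" "{e, c} \<in> F2 i2" "{c, d} \<in> F2 i2" using i12 by (auto simp: F2_def)
      obtain A where "\<And>i. i \<in> I \<Longrightarrow> liftable G S (A i) (F2 i)"
        "\<And>i j. i \<in> I \<Longrightarrow> j \<in> I \<Longrightarrow> i \<noteq> j \<Longrightarrow> A i \<inter> A j = {}"
        using liftable_packing_of_double[OF G S P2 inner2 i2(1) 1(1,2) i2(2,3)] by metis
      then show thesis using that[of A F2] P2 unfolding packing_def by blast
    qed
  qed
qed

section \<open>The lexicographic product\<close>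

lemma simple_graph_lex_product:
  assumes "simple_graph G" "simple_graph H"
  shows "simple_graph (lex_product G H)"
  using assms by (auto simp: simple_graph_def lex_product_def)

lemma lex_product_edge:
  assumes G: "simple_graph G" and "{a, b} \<in> edges G" "i \<in> verts H" "j \<in> verts H"
  shows "{(a, i), (b, j)} \<in> edges (lex_product G H)"
proof -
  have "a \<in> verts G" "b \<in> verts G" "(a, i) \<noteq> (b, j)"
    using simple_graph_edgeD[OF G assms(2)] by auto
  then show ?thesis using assms unfolding lex_product_def by auto
qed

lemma lex_product_edge_fibre:
  assumes H: "simple_graph H" and "a \<in> verts G" "{i, j} \<in> edges H"
  shows "{(a, i), (a, j)} \<in> edges (lex_product G H)"
proof -
  have "i \<in> verts H" "j \<in> verts H" "(a, i) \<noteq> (a, j)"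
    using simple_graph_edgeD[OF H assms(3)] by auto
  then show ?thesis using assms unfolding lex_product_def by auto
qed

text \<open>Two vertices of one fibre are joined through a neighbouring fibre, which exists because
  \<open>G\<close> has a second vertex.\<close>

lemma connected_lex_product:
  assumes G: "connected_graph G" "card (verts G) \<ge> 2" and H: "connected_graph H"
  shows "connected_graph (lex_product G H)"
proof -
  have sG: "simple_graph G" and sH: "simple_graph H" using assms by (auto simp: connected_graph_def)
  have step: "\<exists>c. adj G a c" if a: "a \<in> verts G" for a
  proof -
    obtain b where "b \<in> verts G" "b \<noteq> a"
      using G(2) a by (metis card_le_Suc0_iff_eq card.infinite not_less_eq_eq numeral_2_eq_2 zero_le)
    then have "(adj G)\<^sup>*\<^sup>* a b" using G(1) a by (simp add: connected_graph_def)
    then show ?thesis using \<open>b \<noteq> a\<close> by (metis converse_rtranclpE)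
  qed
  \<comment> \<open>A walk of positive length allows the second coordinate to be changed at will,
    hence the transitive closure without reflexivity.\<close>
  have reach: "(adj (lex_product G H))\<^sup>*\<^sup>* (a, i) (b, j)"
    if "(adj G)\<^sup>+\<^sup>+ a b" "i \<in> verts H" "j \<in> verts H" for a b i j
    using that
  proof (induction arbitrary: j rule: tranclp_induct)
    case (base b)
    then have "adj (lex_product G H) (a, i) (b, j)" using lex_product_edge[OF sG] by (simp add: adj_def)
    then show ?case ..
  next
    case (step b c)
    have "(adj (lex_product G H))\<^sup>*\<^sup>* (a, i) (b, i)" using step by simp
    moreover have "adj (lex_product G H) (b, i) (c, j)"
      using lex_product_edge[OF sG] step by (simp add: adj_def)
    ultimately show ?case by (rule rtranclp.rtrancl_into_rtrancl)
  qed
  have "(adj G)\<^sup>+\<^sup>+ a b" if ab: "a \<in> verts G" "b \<in> verts G" for a b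
  proof -
    obtain c where c: "adj G a c" using step ab by blast
    then have "c \<in> verts G" using simple_graph_edgeD[OF sG] by (auto simp: adj_def)
    then have "(adj G)\<^sup>*\<^sup>* c b" using G(1) ab by (simp add: connected_graph_def)
    with c show ?thesis by (rule rtranclp_into_tranclp2)
  qed
  then have "\<forall>x\<in>verts (lex_product G H). \<forall>y\<in>verts (lex_product G H). (adj (lex_product G H))\<^sup>*\<^sup>* x y"
    using reach by (auto simp: lex_product_def)
  moreover have "verts (lex_product G H) \<noteq> {}"
    using G(1) H by (simp add: lex_product_def connected_graph_def)
  ultimately show ?thesis
    using simple_graph_lex_product[OF sG sH] by (simp add: connected_graph_def)
qed

section \<open>Terminals over three distinct vertices\<close>

text \<open>Each connector of a liftable packing yields one connector for every vertex of
  \<open>H\<close>. Inner vertices stay over its set \<open>A i\<close> and edges between terminals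
  come from its own permitted edges, so different connectors of \<open>G\<close> do not
  interfere.\<close>

lemma distinct_projections_bound:
  fixes G :: "'a ugraph" and H :: "'b ugraph"
  assumes G: "simple_graph G" and H: "simple_graph H" and S: "S \<subseteq> verts G" "card S = 3"
    and \<sigma>: "\<And>s. s \<in> S \<Longrightarrow> \<sigma> s \<in> verts H"
    and P: "packing G S I W F" and I: "finite I"
  shows "card I * card (verts H) \<le> kappa_set (lex_product G H) ((\<lambda>s. (s, \<sigma> s)) ` S)"
proof -
  let ?P = "lex_product G H" and ?\<phi> = "\<lambda>s. (s, \<sigma> s)"
  let ?T = "?\<phi> ` S"
  have T_iff: "(s, j) \<in> ?T \<longleftrightarrow> s \<in> S \<and> j = \<sigma> s" for s j by auto
  \<comment> \<open>A walk is copied into layer \<open>j\<close>, except that terminals keep the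
    height given by \<open>\<sigma>\<close>. This is possible because fibres over adjacent vertices
    are completely joined.\<close>
  have copy: "(link ?P ?T W' F')\<^sup>*\<^sup>* (?\<phi> s) (?\<phi> t)"
    if reach: "(link G S A {})\<^sup>*\<^sup>* s t" and st: "s \<in> S" "t \<in> S" and j: "j \<in> verts H"
      and W': "(A - S) \<times> {j} \<subseteq> W'" for A s t j W' F'
  proof -
    define f where "f x = (x, if x \<in> S then \<sigma> x else j)" for x
    have "link ?P ?T W' F' (f x) (f y)" if "link G S A {} x y" for x y
    proof -
      have "{f x, f y} \<in> edges ?P"
        unfolding f_def by (rule lex_product_edge[OF G]) (use that j \<sigma> in \<open>auto simp: link_def\<close>)
      then show ?thesis
        using that W' by (auto simp: link_def f_def T_iff)
    qed
    then have "(link ?P ?T W' F')\<^sup>*\<^sup>* (f s) (f t)"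
      using rtranclp_lift[OF reach, of "link ?P ?T W' F'" f] by blast
    then show ?thesis using st by (simp add: f_def)
  qed
  have lifts: "\<exists>W' F'. packing ?P ?T (verts H) W' F' \<and>
      (\<forall>j\<in>verts H. W' j \<subseteq> A \<times> UNIV \<and> F' j \<subseteq> (`) ?\<phi> ` F)"
    if "liftable G S A F" for A F
    using that unfolding liftable_def
  proof (elim disjE exE conjE)
    assume J: "joins G S A {}"
    let ?W = "\<lambda>j. (A - S) \<times> {j}"
    have "joins ?P ?T (?W j) {}" if "j \<in> verts H" for j
      using J copy[OF _ _ _ that order_refl] by (auto simp: joins_def)
    then have "packing ?P ?T (verts H) ?W (\<lambda>_. {})"
      by (auto simp: packing_def)
    then show ?thesis by (intro exI[of _ ?W] exI[of _ "\<lambda>_. {}"]) auto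
  next
    fix c e d assume ced: "S = {c, e, d}" "distinct [c, e, d]" and c: "c \<in> A"
      and ec: "{e, c} \<in> F \<inter> edges G" and cd: "(link G S A {})\<^sup>*\<^sup>* c d"
    have inS: "c \<in> S" "e \<in> S" "d \<in> S" using ced by auto
    \<comment> \<open>No edge inside \<open>S\<close> is permitted here, so the first step from
      \<open>c\<close> leads to an inner vertex, each copy of which sees the whole fibre over
      \<open>c\<close>.\<close>
    obtain q where q: "link G S A {} c q" using cd ced by (auto elim: converse_rtranclpE)
    have qe: "{c, q} \<in> edges G" "q \<in> A - S" using q inS by (auto simp: link_def)
    \<comment> \<open>Layer \<open>\<sigma> c\<close> uses the edge between the terminals. In any
      other layer the free vertex \<open>(c, j)\<close> is a detour, adjacent both to
      \<open>(q, j)\<close> and to the terminal over \<open>e\<close>.\<close>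
    define W' where "W' j = (A - S) \<times> {j} \<union> (if j = \<sigma> c then {} else {(c, j)})" for j
    define F' where "F' j = (if j = \<sigma> c then {{?\<phi> e, ?\<phi> c}} else {})" for j
    have "joins ?P ?T (W' j) (F' j)" if j: "j \<in> verts H" for j
    proof -
      let ?r = "link ?P ?T (W' j) (F' j)"
      have d: "?r\<^sup>*\<^sup>* (?\<phi> c) (?\<phi> d)"
        using copy[OF cd inS(1,3) j] by (simp add: W'_def)
      have e: "?r\<^sup>*\<^sup>* (?\<phi> c) (?\<phi> e)"
      proof (cases "j = \<sigma> c")
        case True
        have "?r (?\<phi> e) (?\<phi> c)"
          using True lex_product_edge[OF G, of e c "\<sigma> e" H "\<sigma> c"] ec inS \<sigma> by (auto simp: link_def F'_def)
        then show ?thesis by (meson link_commute r_into_rtranclp)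
      next
        case False
        have "?r (?\<phi> c) (q, j)"
          using lex_product_edge[OF G qe(1), of "\<sigma> c" H j] inS \<sigma> j qe(2)
          by (auto simp: link_def T_iff W'_def)
        moreover have "?r (c, j) (q, j)"
          using False lex_product_edge[OF G qe(1), of j H j] j qe(2)
          by (auto simp: link_def T_iff W'_def)
        moreover have "?r (?\<phi> e) (c, j)"
          using False lex_product_edge[OF G, of e c "\<sigma> e" H j] ec inS \<sigma> j
          by (auto simp: link_def T_iff W'_def)
        ultimately show ?thesis
          by (meson link_commute r_into_rtranclp rtranclp.rtrancl_into_rtrancl)
      qed
      show ?thesis
        by (rule joinsI[of _ _ _ _ "?\<phi> c"]) (use d e ced in auto)
    qed
    moreover have "W' i \<inter> W' j \<subseteq> ?T \<and> F' i \<inter> F' j = {}" if "i \<noteq> j" for i j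
      using that by (auto simp: W'_def F'_def)
    ultimately have "packing ?P ?T (verts H) W' F'"
      by (simp add: packing_def)
    moreover have "W' j \<subseteq> A \<times> UNIV \<and> F' j \<subseteq> (`) ?\<phi> ` F" for j
      using c ec by (auto simp: W'_def F'_def intro!: image_eqI[of _ _ "{e, c}"])
    ultimately show ?thesis by blast
  next
    fix c e d assume ced: "S = {c, e, d}" "distinct [c, e, d]" and cd: "c \<in> A" "d \<in> A"
      and E: "{e, c} \<in> F \<inter> edges G" "{c, d} \<in> F \<inter> edges G"
    have inS: "c \<in> S" "e \<in> S" "d \<in> S" using ced by auto
    \<comment> \<open>The transposition of \<open>\<sigma> c\<close> and \<open>\<sigma> d\<close> matches the free part of the fibre over \<open>c\<close> with that over \<open>d\<close>.\<close>
    define \<tau> where "\<tau> j = (if j = \<sigma> d then \<sigma> c else j)" for j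
    define W' where "W' j = (if j = \<sigma> c then {} else {(c, j), (d, \<tau> j)})" for j
    define F' where "F' j = (if j = \<sigma> c then {{?\<phi> e, ?\<phi> c}, {?\<phi> c, ?\<phi> d}} else {})" for j
    have "joins ?P ?T (W' j) (F' j)" if j: "j \<in> verts H" for j
    proof -
      let ?r = "link ?P ?T (W' j) (F' j)"
      have "?r\<^sup>*\<^sup>* (?\<phi> c) (?\<phi> e) \<and> ?r\<^sup>*\<^sup>* (?\<phi> c) (?\<phi> d)"
      proof (cases "j = \<sigma> c")
        case True
        have "?r (?\<phi> e) (?\<phi> c)"
          using True lex_product_edge[OF G, of e c "\<sigma> e" H "\<sigma> c"] E inS \<sigma> by (auto simp: link_def F'_def)
        moreover have "?r (?\<phi> c) (?\<phi> d)"
          using True lex_product_edge[OF G, of c d "\<sigma> c" H "\<sigma> d"] E inS \<sigma> by (auto simp: link_def F'_def)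
        ultimately show ?thesis by (meson link_commute r_into_rtranclp)
      next
        case False
        have \<tau>: "\<tau> j \<in> verts H" "\<tau> j \<noteq> \<sigma> d" using j False \<sigma> inS by (auto simp: \<tau>_def)
        \<comment> \<open>The connector is the path from the terminal over \<open>c\<close> through
          \<open>(d, \<tau> j)\<close> and \<open>(c, j)\<close> to the terminal over
          \<open>d\<close>, with the terminal over \<open>e\<close> attached to
          \<open>(c, j)\<close>.\<close>
        have "?r (?\<phi> c) (d, \<tau> j)"
          using False lex_product_edge[OF G, of c d "\<sigma> c" H "\<tau> j"] E inS \<sigma> \<tau>
          by (auto simp: link_def T_iff W'_def)
        moreover have "?r (c, j) (d, \<tau> j)"
          using False lex_product_edge[OF G, of c d j H "\<tau> j"] E j \<tau>
          by (auto simp: link_def T_iff W'_def)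
        moreover have "?r (c, j) (?\<phi> d)"
          using False lex_product_edge[OF G, of c d j H "\<sigma> d"] E j inS \<sigma>
          by (auto simp: link_def T_iff W'_def)
        moreover have "?r (?\<phi> e) (c, j)"
          using False lex_product_edge[OF G, of e c "\<sigma> e" H j] E j inS \<sigma>
          by (auto simp: link_def T_iff W'_def)
        ultimately show ?thesis
          by (meson link_commute r_into_rtranclp rtranclp.rtrancl_into_rtrancl)
      qed
      then show ?thesis
        by (intro joinsI[of _ _ _ _ "?\<phi> c"]) (use ced in auto)
    qed
    moreover have "W' i \<inter> W' j \<subseteq> ?T \<and> F' i \<inter> F' j = {}" if "i \<noteq> j" for i j
      using that ced(2) by (auto simp: W'_def F'_def \<tau>_def split: if_splits)
    ultimately have "packing ?P ?T (verts H) W' F'"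
      by (simp add: packing_def)
    moreover have "W' j \<subseteq> A \<times> UNIV \<and> F' j \<subseteq> (`) ?\<phi> ` F" for j
    proof -
      have "{?\<phi> e, ?\<phi> c} = ?\<phi> ` {e, c}" "{?\<phi> c, ?\<phi> d} = ?\<phi> ` {c, d}" by auto
      then have "{?\<phi> e, ?\<phi> c} \<in> (`) ?\<phi> ` F" "{?\<phi> c, ?\<phi> d} \<in> (`) ?\<phi> ` F" using E by blast+
      then show ?thesis using cd by (auto simp: W'_def F'_def)
    qed
    ultimately show ?thesis by blast
  qed
  obtain A and F1 where lift: "\<And>i. i \<in> I \<Longrightarrow> liftable G S (A i) (F1 i)"
    and dis: "\<And>i j. i \<in> I \<Longrightarrow> j \<in> I \<Longrightarrow> i \<noteq> j \<Longrightarrow> A i \<inter> A j = {} \<and> F1 i \<inter> F1 j = {}"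
    using liftable_packing[OF G S(2) P] by metis
  have "\<forall>i\<in>I. \<exists>x. packing ?P ?T (verts H) (fst x) (snd x) \<and>
      (\<forall>j\<in>verts H. fst x j \<subseteq> A i \<times> UNIV \<and> snd x j \<subseteq> (`) ?\<phi> ` F1 i)"
  proof
    fix i assume "i \<in> I"
    from lifts[OF lift[OF this]] obtain W' F' where "packing ?P ?T (verts H) W' F'"
      "\<forall>j\<in>verts H. W' j \<subseteq> A i \<times> UNIV \<and> F' j \<subseteq> (`) ?\<phi> ` F1 i" by blast
    then show "\<exists>x. packing ?P ?T (verts H) (fst x) (snd x) \<and>
      (\<forall>j\<in>verts H. fst x j \<subseteq> A i \<times> UNIV \<and> snd x j \<subseteq> (`) ?\<phi> ` F1 i)"
      by (intro exI[of _ "(W', F')"]) simp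
  qed
  then obtain X where X: "\<forall>i\<in>I. packing ?P ?T (verts H) (fst (X i)) (snd (X i)) \<and>
      (\<forall>j\<in>verts H. fst (X i) j \<subseteq> A i \<times> UNIV \<and> snd (X i) j \<subseteq> (`) ?\<phi> ` F1 i)"
    by (rule bchoice[THEN exE])
  have "packing ?P ?T (I \<times> verts H) (\<lambda>(i, j). fst (X i) j) (\<lambda>(i, j). snd (X i) j)"
    unfolding packing_def
  proof (intro conjI ballI impI)
    fix x assume "x \<in> I \<times> verts H"
    then show "joins ?P ?T (case x of (i, j) \<Rightarrow> fst (X i) j) (case x of (i, j) \<Rightarrow> snd (X i) j)"
      using X by (auto simp: packing_def)
  next
    fix x y assume xy: "x \<in> I \<times> verts H" "y \<in> I \<times> verts H" "x \<noteq> y"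
    obtain i j i' j' where ij: "x = (i, j)" "y = (i', j')" by fastforce
    have "fst (X i) j \<inter> fst (X i') j' \<subseteq> ?T \<and> snd (X i) j \<inter> snd (X i') j' = {}"
    proof (cases "i = i'")
      case True
      then show ?thesis using X xy ij by (auto simp: packing_def)
    next
      case False
      then have d: "A i \<inter> A i' = {}" "F1 i \<inter> F1 i' = {}" using dis xy ij by auto
      have "inj ?\<phi>" by (simp add: inj_def)
      then have "inj ((`) ?\<phi>)" by (intro injI) (simp add: inj_image_eq_iff)
      then have "(`) ?\<phi> ` F1 i \<inter> (`) ?\<phi> ` F1 i' = {}" using d(2) by (metis image_Int image_empty)
      moreover have "snd (X i) j \<inter> snd (X i') j' \<subseteq> (`) ?\<phi> ` F1 i \<inter> (`) ?\<phi> ` F1 i'"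
        by (rule Int_mono) (use X xy ij in auto)
      moreover have "fst (X i) j \<inter> fst (X i') j' \<subseteq> (A i \<times> UNIV) \<inter> (A i' \<times> UNIV)"
        by (rule Int_mono) (use X xy ij in auto)
      moreover have "(A i \<times> (UNIV :: 'b set)) \<inter> (A i' \<times> UNIV) = {}" using d(1) by auto
      ultimately show ?thesis by simp
    qed
    then show "(case x of (i, j) \<Rightarrow> fst (X i) j) \<inter> (case y of (i, j) \<Rightarrow> fst (X i) j) \<subseteq> ?T"
      "(case x of (i, j) \<Rightarrow> snd (X i) j) \<inter> (case y of (i, j) \<Rightarrow> snd (X i) j) = {}"
      using ij by auto
  qed
  moreover have "finite (I \<times> verts H)" using I H by (simp add: simple_graph_def)
  moreover have "?T \<subseteq> verts ?P" using S \<sigma> by (auto simp: lex_product_def)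
  moreover have "card ?T \<ge> 2" using S(2) by (subst card_image) (auto simp: inj_on_def)
  ultimately have "card (I \<times> verts H) \<le> kappa_set ?P ?T"
    using packing_le_kappa_set[OF simple_graph_lex_product[OF G H]] by blast
  then show ?thesis by (simp add: card_cartesian_product)
qed

section \<open>Terminals over two vertices\<close>

lemma connected_graph_neighbour:
  assumes "connected_graph G" "a \<in> verts G" "b \<in> verts G" "a \<noteq> b"
  obtains x where "{a, x} \<in> edges G"
proof -
  have "(adj G)\<^sup>*\<^sup>* a b" using assms by (simp add: connected_graph_def)
  then show thesis using that assms(4) by (metis converse_rtranclpE adj_def)
qed

text \<open>Connectors that avoid the edge between \<open>u\<close> and \<open>v\<close> are copied
  into every layer. At most one connector needs this edge, and its lifts live in the fibres over
  \<open>u\<close> and \<open>v\<close>, which the copies leave free.\<close>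

lemma two_projections_bound:
  fixes G :: "'a ugraph" and H :: "'b ugraph"
  assumes G: "simple_graph G" and H: "connected_graph H"
    and uv: "u \<in> verts G" "v \<in> verts G" "u \<noteq> v"
    and abc: "a \<in> verts H" "b \<in> verts H" "c \<in> verts H" "a \<noteq> b"
    and P0: "packing G {u, v} I W F" and I: "finite I"
  shows "card I * card (verts H) \<le> kappa_set (lex_product G H) {(u, a), (u, b), (v, c)}"
proof -
  let ?P = "lex_product G H" and ?S = "{u, v}" and ?T = "{(u, a), (u, b), (v, c)}"
  have sH: "simple_graph H" and fin: "finite (verts H)"
    using H by (auto simp: connected_graph_def simple_graph_def)
  define W1 F1 where "W1 i = W i - ?S" and "F1 i = F i \<inter> {e \<in> edges G. e \<subseteq> ?S}" for i
  have P: "packing G ?S I W1 F1"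
    using packing_restrict[OF P0] by (simp add: W1_def[abs_def] F1_def[abs_def])
  let ?N = "{i \<in> I. \<not> joins G ?S (W1 i) {}}"
  have N: "{u, v} \<in> F1 i" if i: "i \<in> ?N" for i
  proof -
    have "joins G ?S (W1 i) (F1 i)" using P i by (simp add: packing_def)
    then have "F1 i \<noteq> {}" using i by auto
    then obtain e where e: "e \<in> F1 i" by blast
    then have "e \<subseteq> ?S" "card e = 2" using G by (auto simp: F1_def simple_graph_def)
    then have "e = ?S" using uv(3) by (intro card_subset_eq) auto
    then show ?thesis using e by simp
  qed
  have uniq: "i = i'" if "i \<in> ?N" "i' \<in> ?N" for i i'
    using N[OF that(1)] N[OF that(2)] P that unfolding packing_def by blast
  have W1: "W1 i \<inter> W1 i' = {}" if "i \<in> I" "i' \<in> I" "i \<noteq> i'" for i i'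
    using P that unfolding packing_def by (auto simp: W1_def)
  \<comment> \<open>Since \<open>a \<noteq> b\<close>, the graph \<open>H\<close> has a second
    vertex and \<open>c\<close> a neighbour. The edge from \<open>c\<close> to \<open>h\<close> is
    used inside the fibre over \<open>v\<close>.\<close>
  obtain h where h: "{c, h} \<in> edges H"
    using connected_graph_neighbour[OF H abc(3)] abc by metis
  have ch: "h \<in> verts H" "c \<noteq> h" using simple_graph_edgeD[OF sH h] by auto
  \<comment> \<open>Setting aside \<open>c\<close> and \<open>h\<close> over \<open>v\<close>, and
    \<open>a\<close> and \<open>b\<close> over \<open>u\<close>, leaves equally many vertices, which
    \<open>\<tau>\<close> matches.\<close>
  have "card (verts H - {c, h}) = card (verts H - {a, b})"
    using abc ch fin by (simp add: card_Diff_subset)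
  then obtain \<tau> where \<tau>: "bij_betw \<tau> (verts H - {c, h}) (verts H - {a, b})"
    using fin by (meson finite_Diff finite_same_card_bij)
  have \<tau>_in: "\<tau> j \<in> verts H" "\<tau> j \<noteq> a" "\<tau> j \<noteq> b" if "j \<in> verts H" "j \<noteq> c" "j \<noteq> h" for j
    using bij_betwE[OF \<tau>] that by auto
  have \<tau>_inj: "\<tau> j \<noteq> \<tau> j'" if "j \<in> verts H - {c, h}" "j' \<in> verts H - {c, h}" "j \<noteq> j'" for j j'
    using \<tau> that by (auto simp: bij_betw_def dest: inj_onD)
  \<comment> \<open>Layer \<open>c\<close> takes the two direct edges and layer \<open>h\<close> the
    star around \<open>(v, h)\<close>. Elsewhere \<open>(v, j)\<close> sees both terminals over
    \<open>u\<close>, and \<open>(u, \<tau> j)\<close> links it to \<open>(v, c)\<close>.\<close>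
  define W2 where "W2 j = (if j = c then {} else if j = h then {(v, h)} else {(v, j), (u, \<tau> j)})" for j
  define F2 where "F2 j = (if j = c then {{(u, a), (v, c)}, {(u, b), (v, c)}} else {})" for j
  define W3 where "W3 x = (if fst x \<in> ?N then W2 (snd x) else W1 (fst x) \<times> {snd x})" for x
  define F3 where "F3 x = (if fst x \<in> ?N then F2 (snd x) else {})" for x
  have inner: "joins ?P ?T (W1 i \<times> {j}) {}" if i: "i \<in> I" "i \<notin> ?N" and j: "j \<in> verts H" for i j
  proof -
    let ?r = "link ?P ?T (W1 i \<times> {j}) {}"
    \<comment> \<open>One copy serves both terminals over \<open>u\<close>, because its final step
      can end anywhere in that fibre.\<close>
    have copy: "?r\<^sup>*\<^sup>* (v, c) (u, k)" if k: "k \<in> {a, b}" for k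
    proof -
      define f where "f x = (x, if x = u then k else if x = v then c else j)" for x
      have "?r (f x) (f y)" if xy: "link G ?S (W1 i) {} x y" for x y
      proof -
        have "{f x, f y} \<in> edges ?P"
          unfolding f_def by (rule lex_product_edge[OF G]) (use xy abc j k in \<open>auto simp: link_def\<close>)
        then show ?thesis using xy k uv(3) by (auto simp: link_def f_def)
      qed
      moreover have "(link G ?S (W1 i) {})\<^sup>*\<^sup>* v u" using i by (simp add: joins_def)
      ultimately have "?r\<^sup>*\<^sup>* (f v) (f u)"
        using rtranclp_lift[of "link G ?S (W1 i) {}" v u ?r f] by blast
      then show ?thesis using uv(3) by (simp add: f_def)
    qed
    show ?thesis by (rule joinsI[of _ _ _ _ "(v, c)"]) (use copy in auto)
  qed
  have direct: "joins ?P ?T (W2 j) (F2 j)" if e: "{u, v} \<in> edges G" and j: "j \<in> verts H" for j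
  proof -
    let ?r = "link ?P ?T (W2 j) (F2 j)"
    have E: "{(u, i), (v, k)} \<in> edges ?P" if "i \<in> verts H" "k \<in> verts H" for i k
      by (rule lex_product_edge[OF G e that])
    consider "j = c" | "j = h" | "j \<noteq> c" "j \<noteq> h" by blast
    then have "?r\<^sup>*\<^sup>* (v, c) (u, a) \<and> ?r\<^sup>*\<^sup>* (v, c) (u, b)"
    proof cases
      case 1
      then have "?r (u, a) (v, c)" "?r (u, b) (v, c)" using E abc by (auto simp: link_def F2_def)
      then show ?thesis by (meson link_commute r_into_rtranclp)
    next
      case 2
      then have "?r (u, a) (v, h)" "?r (u, b) (v, h)" "?r (v, c) (v, h)"
        using E abc ch uv lex_product_edge_fibre[OF sH uv(2) h] by (auto simp: link_def W2_def)
      then show ?thesis by (meson link_commute r_into_rtranclp rtranclp.rtrancl_into_rtrancl)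
    next
      case 3
      then have "?r (u, a) (v, j)" "?r (u, b) (v, j)" "?r (u, \<tau> j) (v, j)" "?r (u, \<tau> j) (v, c)"
        using E abc uv \<tau>_in[OF j] j by (auto simp: link_def W2_def)
      then show ?thesis by (meson link_commute r_into_rtranclp rtranclp.rtrancl_into_rtrancl)
    qed
    then show ?thesis by (intro joinsI[of _ _ _ _ "(v, c)"]) auto
  qed
  have "packing ?P ?T (I \<times> verts H) W3 F3"
    unfolding packing_def
  proof (intro conjI ballI impI)
    fix x assume x: "x \<in> I \<times> verts H"
    show "joins ?P ?T (W3 x) (F3 x)"
    proof (cases "fst x \<in> ?N")
      case True
      then have "{u, v} \<in> edges G" using N by (auto simp: F1_def)
      then show ?thesis using direct[of "snd x"] True x by (auto simp: W3_def F3_def)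
    next
      case False
      then show ?thesis using inner[of "fst x" "snd x"] x by (auto simp: W3_def F3_def)
    qed
  next
    fix x y assume xy: "x \<in> I \<times> verts H" "y \<in> I \<times> verts H" "x \<noteq> y"
    have W12: "(p, q) \<notin> W2 j" if "p \<in> W1 i" for p q i j
      using that by (auto simp: W1_def W2_def split: if_splits)
    have W2_dis: "W2 j \<inter> W2 j' = {}" if "j \<in> verts H" "j' \<in> verts H" "j \<noteq> j'" for j j'
      using that \<tau>_inj[of j j'] uv(3) by (auto simp: W2_def)
    show "W3 x \<inter> W3 y \<subseteq> ?T"
    proof (cases "fst x \<in> ?N \<and> fst y \<in> ?N")
      case True
      then have "fst x = fst y" using uniq by blast
      then have "snd x \<noteq> snd y" using xy by (auto simp: prod_eq_iff)
      then have "W3 x \<inter> W3 y = {}" using True W2_dis[of "snd x" "snd y"] xy by (auto simp: W3_def)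
      then show ?thesis by simp
    next
      case False
      then have "W3 x \<inter> W3 y = {}"
        using W1[of "fst x" "fst y"] xy
        by (auto simp: W3_def prod_eq_iff dest: W12)
      then show ?thesis by simp
    qed
    show "F3 x \<inter> F3 y = {}"
      using xy uniq[of "fst x" "fst y"] by (auto simp: F3_def F2_def prod_eq_iff)
  qed
  moreover have "finite (I \<times> verts H)" using I fin by simp
  moreover have "?T \<subseteq> verts ?P" using uv abc by (auto simp: lex_product_def)
  moreover have "card ?T \<ge> 2" using uv abc by simp
  ultimately have "card (I \<times> verts H) \<le> kappa_set ?P ?T"
    using packing_le_kappa_set[OF simple_graph_lex_product[OF G sH]] by blast
  then show ?thesis by (simp add: card_cartesian_product)
qed

section \<open>Terminals over a single vertex\<close>

text \<open>Disjoint connectors between \<open>u\<close> and another vertex leave \<open>u\<close>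
  towards distinct neighbours, as only one of them can use the direct edge.\<close>

lemma kappa_3_le_degree:
  assumes G: "connected_graph G" "card (verts G) \<ge> 2" and u: "u \<in> verts G"
  shows "kappa 3 G \<le> card {x. {u, x} \<in> edges G}"
proof -
  have sG: "simple_graph G" and fin: "finite (verts G)"
    using G by (auto simp: connected_graph_def simple_graph_def)
  obtain v where v: "v \<in> verts G" "v \<noteq> u"
    using G(2) u fin by (metis card_le_Suc0_iff_eq not_less_eq_eq numeral_2_eq_2)
  obtain I :: "'a list set" and W F
    where I: "finite I" "kappa 3 G \<le> card I" and P: "packing G {u, v} I W F"
    using kappa_3_two_vertex_packing[OF G(1) u v(1)] v(2) by metis
  have "\<forall>i\<in>I. \<exists>x. link G {u, v} (W i) (F i) u x"
  proof
    fix i assume "i \<in> I"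
    then have "joins G {u, v} (W i) (F i)" using P by (simp add: packing_def)
    then show "\<exists>x. link G {u, v} (W i) (F i) u x"
      using joins_imp_link[of G "{u, v}" "W i" "F i" u v] v(2) by blast
  qed
  then obtain f where f: "\<forall>i\<in>I. link G {u, v} (W i) (F i) u (f i)"
    by (rule bchoice[THEN exE])
  have "inj_on f I"
  proof (rule inj_onI, rule ccontr)
    fix i j assume ij: "i \<in> I" "j \<in> I" "f i = f j" "i \<noteq> j"
    have "W i \<inter> W j \<subseteq> {u, v}" "F i \<inter> F j = {}" using P ij by (auto simp: packing_def)
    moreover have "link G {u, v} (W i) (F i) u (f i)" "link G {u, v} (W j) (F j) u (f i)"
      using f ij by auto
    moreover from this have "u \<noteq> f i"
      by (intro simple_graph_edgeD(3)[OF sG]) (simp add: link_def)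
    ultimately show False by (auto simp: link_def)
  qed
  moreover have "f ` I \<subseteq> {x. {u, x} \<in> edges G}" using f by (auto simp: link_def)
  moreover have "finite {x. {u, x} \<in> edges G}"
    by (rule finite_subset[OF _ fin]) (use simple_graph_edgeD[OF sG] in auto)
  ultimately have "card I \<le> card {x. {u, x} \<in> edges G}" by (rule card_inj_on_le)
  then show ?thesis using I by simp
qed

text \<open>Each vertex over a neighbour of \<open>u\<close> is adjacent to the whole fibre over
  \<open>u\<close>, so it is the centre of a star on \<open>S\<close>.\<close>

lemma one_projection_bound:
  assumes G: "simple_graph G" and H: "simple_graph H"
    and S: "S \<subseteq> {u} \<times> verts H" "card S \<ge> 2" and u: "u \<in> verts G"
  shows "card {x. {u, x} \<in> edges G} * card (verts H) \<le> kappa_set (lex_product G H) S"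
proof -
  let ?P = "lex_product G H" and ?N = "{x. {u, x} \<in> edges G}"
  have fin: "finite ?N"
    by (rule finite_subset[of _ "verts G"]) (use G simple_graph_edgeD[OF G] in \<open>auto simp: simple_graph_def\<close>)
  have "joins ?P S {x} {}" if x: "x \<in> ?N \<times> verts H" for x
  proof (rule joinsI[of _ _ _ _ x])
    fix s assume s: "s \<in> S"
    obtain n j where nj: "x = (n, j)" by (cases x)
    obtain k where k: "s = (u, k)" "k \<in> verts H" using s S by auto
    have "{x, s} \<in> edges ?P"
      using lex_product_edge[OF G, of u n k H j] x k nj by (simp add: insert_commute)
    moreover have "x \<notin> S" using x nj S simple_graph_edgeD[OF G, of u n] by auto
    ultimately show "(link ?P S {x} {})\<^sup>*\<^sup>* x s" using s by (intro r_into_rtranclp) (simp add: link_def)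
  qed
  then have "packing ?P S (?N \<times> verts H) (\<lambda>x. {x}) (\<lambda>_. {})"
    by (simp add: packing_def)
  moreover have "finite (?N \<times> verts H)" using fin H by (simp add: simple_graph_def)
  moreover have "S \<subseteq> verts ?P" using S u by (auto simp: lex_product_def)
  ultimately have "card (?N \<times> verts H) \<le> kappa_set ?P S"
    using packing_le_kappa_set[OF simple_graph_lex_product[OF G H]] S by blast
  then show ?thesis by (simp add: card_cartesian_product)
qed

section \<open>The bound for arbitrary terminals and for the product\<close>

lemma kappa_set_lex_product_ge:
  fixes G :: "'a ugraph" and H :: "'b ugraph"
  assumes G: "connected_graph G" "card (verts G) \<ge> 2" and H: "connected_graph H"
    and S: "S \<subseteq> verts (lex_product G H)" "card S = 3"
  shows "kappa 3 G * card (verts H) \<le> kappa_set (lex_product G H) S"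
proof -
  have sG: "simple_graph G" and sH: "simple_graph H" using G H by (auto simp: connected_graph_def)
  have S': "S \<subseteq> verts G \<times> verts H" using S by (simp add: lex_product_def)
  show ?thesis
  proof (cases "inj_on fst S")
    case True
    \<comment> \<open>When the first coordinates are distinct, the second is a function of the
      first.\<close>
    define \<sigma> where "\<sigma> s = snd (inv_into S fst s)" for s
    have \<sigma>: "\<sigma> (fst x) = snd x" if "x \<in> S" for x using that True by (simp add: \<sigma>_def)
    then have eq: "S = (\<lambda>s. (s, \<sigma> s)) ` fst ` S" by (force simp: image_image)
    have S3: "fst ` S \<subseteq> verts G" "card (fst ` S) = 3"
      using S' S(2) True by (auto simp: card_image)
    obtain I :: "'a ugraph set" and W F where "finite I" "card I = kappa 3 G" "packing G (fst ` S) I W F"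
      by (rule kappa_packing[OF G(1) S3])
    then have "kappa 3 G * card (verts H) \<le> kappa_set (lex_product G H) ((\<lambda>s. (s, \<sigma> s)) ` fst ` S)"
      using distinct_projections_bound[OF sG sH S3, of \<sigma> I W F] \<sigma> S' by fastforce
    then show ?thesis using eq by simp
  next
    case False
    then obtain x y where "x \<in> S" "y \<in> S" "fst x = fst y" "x \<noteq> y" by (auto simp: inj_on_def)
    then obtain u a b where uab: "(u, a) \<in> S" "(u, b) \<in> S" "a \<noteq> b"
      by (cases x; cases y) auto
    have finS: "finite S" using S(2) by (simp add: card_ge_0_finite)
    have "card (S - {(u, a), (u, b)}) = 1" using S(2) uab finS by (simp add: card_Diff_subset)
    then obtain z where z: "S - {(u, a), (u, b)} = {z}" by (auto simp: card_1_singleton_iff)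
    obtain v c where vc: "z = (v, c)" by (cases z)
    have "S = {(u, a), (u, b)} \<union> (S - {(u, a), (u, b)})" using uab by blast
    also have "\<dots> = {(u, a), (u, b), (v, c)}" unfolding z vc by auto
    finally have eq: "S = {(u, a), (u, b), (v, c)}" .
    have mem: "u \<in> verts G" "v \<in> verts G" "a \<in> verts H" "b \<in> verts H" "c \<in> verts H"
      using S' unfolding eq by auto
    show ?thesis
    proof (cases "u = v")
      case True
      then have "S \<subseteq> {u} \<times> verts H" using eq mem by auto
      then have "card {x. {u, x} \<in> edges G} * card (verts H) \<le> kappa_set (lex_product G H) S"
        using one_projection_bound[OF sG sH _ _ mem(1)] S(2) by simp
      then show ?thesis
        using mult_le_mono1[OF kappa_3_le_degree[OF G mem(1)]] le_trans by blast
    next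
      case False
      obtain I :: "'a list set" and W F
        where I: "finite I" "kappa 3 G \<le> card I" "packing G {u, v} I W F"
        by (rule kappa_3_two_vertex_packing[OF G(1) mem(1,2) False])
      have "card I * card (verts H) \<le> kappa_set (lex_product G H) S"
        using two_projections_bound[OF sG H mem(1,2) False mem(3-5) uab(3) I(3,1)] eq by simp
      then show ?thesis using mult_le_mono1[OF I(2)] le_trans by blast
    qed
  qed
qed

lemma kappa_3_lex_product_ge:
  assumes G: "connected_graph G" "card (verts G) \<ge> 2" and H: "connected_graph H"
  shows "kappa 3 G * card (verts H) \<le> kappa 3 (lex_product G H)"
proof -
  let ?P = "lex_product G H"
  have P: "connected_graph ?P" by (rule connected_lex_product[OF G H])
  have cardP: "card (verts ?P) = card (verts G) * card (verts H)"
    by (simp add: lex_product_def card_cartesian_product)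
  have "card (verts H) > 0"
    using H by (auto simp: connected_graph_def simple_graph_def card_gt_0_iff)
  show ?thesis
  proof (cases "card (verts ?P) < 3")
    case True
    \<comment> \<open>A product with fewer than three vertices forces \<open>G\<close> to have two
      and \<open>H\<close> one, so both values of \<open>kappa 3\<close> are 1 by
      convention.\<close>
    have "card (verts H) = 1"
    proof (rule ccontr)
      assume "card (verts H) \<noteq> 1"
      then have "2 * 2 \<le> card (verts G) * card (verts H)"
        using \<open>card (verts H) > 0\<close> G(2) by (intro mult_le_mono) auto
      then show False using True cardP by simp
    qed
    then show ?thesis using True cardP P G by (simp add: kappa_def)
  next
    case False
    let ?K = "{kappa_set ?P S | S. S \<subseteq> verts ?P \<and> card S = 3}"
    have fin: "finite (verts ?P)" using P by (simp add: connected_graph_def simple_graph_def)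
    have "?K \<subseteq> kappa_set ?P ` Pow (verts ?P)" by auto
    then have "finite ?K" using fin by (meson finite_Pow_iff finite_imageI finite_subset)
    moreover obtain S0 where "S0 \<subseteq> verts ?P" "card S0 = 3"
      using False by (meson linorder_not_less obtain_subset_with_card_n)
    then have "?K \<noteq> {}" by blast
    ultimately have "Min ?K \<in> ?K" by (rule Min_in)
    then obtain S where "S \<subseteq> verts ?P" "card S = 3" "Min ?K = kappa_set ?P S" by blast
    then show ?thesis
      using kappa_set_lex_product_ge[OF G H] False P by (simp add: kappa_def)
  qed
qed

theorem theorem1p11:
  "(\<forall>(G :: 'a ugraph) (H :: 'b ugraph).
      connected_graph G \<and> connected_graph H \<and> card (verts G) \<ge> 2 \<longrightarrow>
      kappa 3 (lex_product G H) \<ge> kappa 3 G * card (verts H)) \<and>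
   (\<exists>(G :: nat ugraph) (H :: nat ugraph).
      connected_graph G \<and> connected_graph H \<and> card (verts G) \<ge> 2 \<and>
      kappa 3 (lex_product G H) = kappa 3 G * card (verts H))"
proof (intro conjI allI impI)
  fix G :: "'a ugraph" and H :: "'b ugraph"
  assume "connected_graph G \<and> connected_graph H \<and> card (verts G) \<ge> 2"
  then show "kappa 3 (lex_product G H) \<ge> kappa 3 G * card (verts H)"
    using kappa_3_lex_product_ge by blast
next
  \<comment> \<open>The product of these two graphs also has two vertices, so equality reads 1 = 1 *
    1 by the convention for small graphs.\<close>
  define G :: "nat ugraph" where "G = \<lparr>verts = {0, 1}, edges = {{0, 1}}\<rparr>"
  define H :: "nat ugraph" where "H = \<lparr>verts = {0}, edges = {}\<rparr>"
  have "adj G 0 1" "adj G 1 0" by (auto simp: G_def adj_def)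
  then have G: "connected_graph G" "card (verts G) = 2"
    by (auto simp: G_def connected_graph_def simple_graph_def)
  have H: "connected_graph H" "card (verts H) = 1"
    by (auto simp: H_def connected_graph_def simple_graph_def)
  have "connected_graph (lex_product G H)" using connected_lex_product[OF G(1) _ H(1)] G(2) by simp
  moreover have "card (verts (lex_product G H)) = 2"
    using G(2) H(2) by (simp add: lex_product_def card_cartesian_product)
  ultimately have "kappa 3 (lex_product G H) = kappa 3 G * card (verts H)"
    using G H by (simp add: kappa_def)
  then show "\<exists>(G :: nat ugraph) (H :: nat ugraph). connected_graph G \<and> connected_graph H \<and>
      card (verts G) \<ge> 2 \<and> kappa 3 (lex_product G H) = kappa 3 G * card (verts H)"
    using G H by (intro exI[of _ G] exI[of _ H]) simp
qed

end
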